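(* Let $(\mathcal V,\mathcal E)$ be a star-shaped network and $T>0$. Let $u^e=(\rho^e,v^e)$ and $\hat u^e=(\hat\rho^e,\hat v^e)$, $e\in\mathcal E$, be Lipschitz continuous solutions, on every edge $e\in\mathcal E$, of the original system $$\partial_t\rho^e+\partial_x m^e=0,\qquad \partial_t v^e+\partial_x h^e=-\gamma|v^e|v^e,\qquad 0<x<\ell^e,\ 0<t<T,$$ and of the observer system $$\partial_t\hat\rho^e+\partial_x\hat m^e=\mathcal L_\rho,\qquad \partial_t\hat v^e+\partial_x\hat h^e=-\gamma|\hat v^e|\hat v^e+\mathcal L_v,\qquad 0<x<\ell^e,\ 0<t<T,$$ respectively, with initial data $u_0^e=(\rho_0^e,v_0^e)$ and $\hat u_0^e=(\hat\rho_0^e,\hat v_0^e)$, with boundary conditions $$m^e(t,\nu)=\hat m^e(t,\nu)=m_b^e(t,\nu)\qquad\text{for all }\nu\in\mathcal V_\partial,$$ and with source terms given either by those for velocity measurements, $\mathcal L_\rho=0$, $\mathcal L_v=\mu(v^e-\hat v^e)$, or by those for mass flow measurements, $\mathcal L_\rho=0$, $\mathcal L_v=\mu(m^e-\hat m^e)$, with $\mu>0$. Assume that both solutions satisfy the coupling conditions at the inner node and that on all pipes $e\in\mathcal E$ the following hold. (A1) $(\rho^e,v^e)\in\big(C^0([0,T];W^{1,\infty}(0,\ell^e))\cap W^{1,\infty}(0,T;L^\infty(0,\ell^e))\big)^2$ satisfies the original system pointwise almost everywhere, and there are $\underline\rho,\bar\rho,\tilde v>0$ with $0<\underline\rho\le\rho^e\le\bar\rho$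 and $-\tilde v\le v^e\le\tilde v$ on $[0,T]\times[0,\ell^e]$. (A2) $\rho P''(\rho)\ge4|\tilde v|^2$ for all $\underline\rho\le\rho\le\bar\rho$. (A3) $(\hat\rho^e,\hat v^e)\in\big(C^0([0,T];W^{1,\infty}(0,\ell^e))\cap W^{1,\infty}(0,T;L^\infty(0,\ell^e))\big)^2$ satisfies $0<\underline\rho\le\hat\rho^e\le\bar\rho$ and $-\tilde v\le\hat v^e\le\tilde v$ on $[0,T]\times[0,\ell^e]$. (A4) The bounds $$\|\partial_t\rho^e\|_{L^\infty(0,T;L^\infty(0,\ell^e))}+\|\partial_tv^e\|_{L^\infty(0,T;L^\infty(0,\ell^e))}\le C_t,\qquad \|v^e\|_{L^\infty(0,T;L^\infty(0,\ell^e))},\ \|\hat v^e\|_{L^\infty(0,T;L^\infty(0,\ell^e))}\le\bar v$$ hold with $C_t,\bar v>0$ sufficiently small. Then there exist constants $C_1,C_2,C_3>0$ such that $$\|u(t,\cdot)-\hat u(t,\cdot)\|_{L^2(\mathcal E)}^2\le C_1\|u_0-\hat u_0\|_{L^2(\mathcal E)}^2\exp(-C_2t)+C_3|\Delta M_0|$$ for all $0\le t\le T$, with the mass difference at time $t=0$ $$\Delta M_0:=\sum_{e\in\mathcal E}\int_0^{\ell^e}\rho^e_0(x)\,dx-\sum_{e\in\mathcal E}\int_0^{\ell^e}\hat\rho^e_0(x)\,dx.$$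
   Context: $p:(0,\infty)\to\mathbb R$ is smooth and strictly monotone with $p'>0$; the pressure potential $P$ is smooth and strictly convex with $p'(\rho)=\rho P''(\rho)$; $\gamma\ge0$ is the friction coefficient. Notation: $m^e=\rho^ev^e$, $h^e=\frac12(v^e)^2+P'(\rho^e)$, and analogously $\hat m^e,\hat h^e$. A star-shaped network $(\mathcal V,\mathcal E)$ has exactly one inner node $\nu_0$; all other nodes are boundary nodes (set $\mathcal V_\partial$), and every edge $e\in\mathcal E$, identified with the interval $(0,\ell^e)$, starts in $\nu_0$ ($x=0$) and ends at a boundary node ($x=\ell^e$). All pipes have the same diameter. In the boundary conditions, $e$ is the edge incident to the boundary node $\nu$, and they hold for $0\le t\le T$. The coupling conditions at $\nu_0$ are $\sum_{e\in\mathcal E}m^e(\nu_0)=0$ and $h^e(\nu_0)=h^f(\nu_0)$ for all $e,f\in\mathcal E$ (and the same for the observer quantities with hats). $\|u-\hat u\|_{L^2(\mathcal E)}^2=\sum_{e\in\mathcal E}\|u^e-\hat u^e\|_{L^2(0,\ell^e)}^2$. *)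

theory Defs
  imports "HOL-Analysis.Analysis" "HOL-Probability.Essential_Supremum" "Graph_Theory.Digraph"
begin

section \<open>Star-shaped networks\<close>

definition incident_edges :: "('v, 'e) pre_digraph \<Rightarrow> 'v \<Rightarrow> 'e set" where
  "incident_edges G \<nu> = in_arcs G \<nu> \<union> out_arcs G \<nu>"

definition boundary_nodes :: "('v, 'e) pre_digraph \<Rightarrow> 'v set" where
  "boundary_nodes G = {\<nu> \<in> verts G. card (incident_edges G \<nu>) = 1}"

definition inner_nodes :: "('v, 'e) pre_digraph \<Rightarrow> 'v set" where
  "inner_nodes G = verts G - boundary_nodes G"

text \<open>The edge \<open>e\<close> is identified with the interval \<open>(0, len e)\<close>; its point \<open>x = 0\<close> is the tail
  and \<open>x = len e\<close> is the head.\<close>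

definition star_network :: "('v, 'e) pre_digraph \<Rightarrow> ('e \<Rightarrow> real) \<Rightarrow> 'v \<Rightarrow> bool" where
  "star_network G len \<nu>0 \<longleftrightarrow>
     fin_digraph G \<and> inner_nodes G = {\<nu>0} \<and>
     (\<forall>e\<in>arcs G. tail G e = \<nu>0 \<and> head G e \<in> boundary_nodes G \<and> len e > 0)"

section \<open>Pressure law\<close>

definition smooth_on_pos :: "(real \<Rightarrow> real) \<Rightarrow> bool" where
  "smooth_on_pos f \<longleftrightarrow> (\<forall>n. \<forall>r>0. (deriv ^^ n) f differentiable (at r))"

definition strictly_convex_on :: "real set \<Rightarrow> (real \<Rightarrow> real) \<Rightarrow> bool" where
  "strictly_convex_on S f \<longleftrightarrow> convex S \<and>
     (\<forall>x\<in>S. \<forall>y\<in>S. \<forall>s. x \<noteq> y \<and> 0 < s \<and> s < 1 \<longrightarrow>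
        f ((1 - s) * x + s * y) < (1 - s) * f x + s * f y)"

definition pressure_law :: "(real \<Rightarrow> real) \<Rightarrow> (real \<Rightarrow> real) \<Rightarrow> bool" where
  "pressure_law p P \<longleftrightarrow>
     smooth_on_pos p \<and> strict_mono_on {0<..} p \<and> (\<forall>r>0. deriv p r > 0) \<and>
     smooth_on_pos P \<and> strictly_convex_on {0<..} P \<and>
     (\<forall>r>0. deriv p r = r * deriv (deriv P) r)"

section \<open>Function spaces\<close>

text \<open>A function of time and space on one edge is a curried function \<open>u t x\<close>.\<close>

definition Linf_norm :: "'a::euclidean_space set \<Rightarrow> ('a \<Rightarrow> real) \<Rightarrow> ereal" where
  "Linf_norm S f = esssup (lebesgue_on S) (\<lambda>z. ereal \<bar>f z\<bar>)"

definition Linf :: "'a::euclidean_space set \<Rightarrow> ('a \<Rightarrow> real) set" where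
  "Linf S = {f. f \<in> borel_measurable (lebesgue_on S) \<and> Linf_norm S f < \<infinity>}"

definition test_function :: "real \<Rightarrow> real \<Rightarrow> (real \<Rightarrow> real) \<Rightarrow> bool" where
  "test_function a b \<phi> \<longleftrightarrow>
     (\<forall>n x. (deriv ^^ n) \<phi> differentiable (at x)) \<and>
     (\<exists>c d. a < c \<and> d < b \<and> (\<forall>x. \<phi> x \<noteq> 0 \<longrightarrow> x \<in> {c..d}))"

definition weak_deriv :: "real \<Rightarrow> real \<Rightarrow> (real \<Rightarrow> real) \<Rightarrow> (real \<Rightarrow> real) \<Rightarrow> bool" where
  "weak_deriv a b f g \<longleftrightarrow> (\<forall>\<phi>. test_function a b \<phi> \<longrightarrow>
     (LINT x|lebesgue_on {a<..<b}. f x * deriv \<phi> x) =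
     - (LINT x|lebesgue_on {a<..<b}. g x * \<phi> x))"

text \<open>\<open>C\<^sup>0([0,T]; W\<^sup>1\<^sup>,\<^sup>\<infinity>(0,L))\<close>\<close>

definition C0_W1inf :: "real \<Rightarrow> real \<Rightarrow> (real \<Rightarrow> real \<Rightarrow> real) \<Rightarrow> bool" where
  "C0_W1inf T L u \<longleftrightarrow> (\<exists>ux.
     (\<forall>t\<in>{0..T}. u t \<in> Linf {0<..<L} \<and> ux t \<in> Linf {0<..<L} \<and> weak_deriv 0 L (u t) (ux t)) \<and>
     (\<forall>t\<in>{0..T}.
        ((\<lambda>s. Linf_norm {0<..<L} (\<lambda>x. u s x - u t x) + Linf_norm {0<..<L} (\<lambda>x. ux s x - ux t x))
           \<longlongrightarrow> 0) (at t within {0..T})))"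

definition rect :: "real \<Rightarrow> real \<Rightarrow> (real \<times> real) set" where
  "rect T L = {0<..<T} \<times> {0<..<L}"

text \<open>\<open>W\<^sup>1\<^sup>,\<^sup>\<infinity>(0,T; L\<^sup>\<infinity>(0,L))\<close>, with \<open>L\<^sup>\<infinity>(0,T; L\<^sup>\<infinity>(0,L))\<close> read as \<open>L\<^sup>\<infinity>((0,T) \<times> (0,L))\<close>. The
  identity defining the weak time derivative holds between elements of \<open>L\<^sup>\<infinity>(0,L)\<close>, i.e. for almost
  every \<open>x\<close>.\<close>

definition W1inf_Linf :: "real \<Rightarrow> real \<Rightarrow> (real \<Rightarrow> real \<Rightarrow> real) \<Rightarrow> bool" where
  "W1inf_Linf T L u \<longleftrightarrow>
     (\<lambda>(t, x). u t x) \<in> Linf (rect T L) \<and>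
     (\<exists>ut. (\<lambda>(t, x). ut t x) \<in> Linf (rect T L) \<and>
        (\<forall>\<phi>. test_function 0 T \<phi> \<longrightarrow>
           (AE x in lebesgue_on {0<..<L}.
              (LINT t|lebesgue_on {0<..<T}. u t x * deriv \<phi> t) =
              - (LINT t|lebesgue_on {0<..<T}. ut t x * \<phi> t))))"

text \<open>Lipschitz continuity on the closed rectangle selects the representative whose values at
  \<open>t = 0\<close>, at the end points of the edge and in the pointwise bounds are meant.\<close>

definition regular :: "real \<Rightarrow> real \<Rightarrow> (real \<Rightarrow> real \<Rightarrow> real) \<Rightarrow> bool" where
  "regular T L u \<longleftrightarrow>
     (\<exists>K. K-lipschitz_on ({0..T} \<times> {0..L}) (\<lambda>(t, x). u t x)) \<and>
     C0_W1inf T L u \<and> W1inf_Linf T L u"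

section \<open>Original system and observer system\<close>

definition mass_flow ::
  "(real \<Rightarrow> real \<Rightarrow> real) \<Rightarrow> (real \<Rightarrow> real \<Rightarrow> real) \<Rightarrow> real \<Rightarrow> real \<Rightarrow> real" where
  "mass_flow \<rho> v t x = \<rho> t x * v t x"

definition enthalpy ::
  "(real \<Rightarrow> real) \<Rightarrow> (real \<Rightarrow> real \<Rightarrow> real) \<Rightarrow> (real \<Rightarrow> real \<Rightarrow> real) \<Rightarrow> real \<Rightarrow> real \<Rightarrow> real" where
  "enthalpy P \<rho> v t x = 1 / 2 * (v t x)\<^sup>2 + deriv P (\<rho> t x)"

text \<open>The equations hold with classical partial derivatives at almost every point of
  \<open>(0,T) \<times> (0,L)\<close>. For Lipschitz continuous functions these derivatives exist almost everywhere
  and agree there with the weak ones.\<close>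

definition solves_system ::
  "(real \<Rightarrow> real) \<Rightarrow> real \<Rightarrow> real \<Rightarrow> real \<Rightarrow> (real \<Rightarrow> real \<Rightarrow> real) \<Rightarrow> (real \<Rightarrow> real \<Rightarrow> real) \<Rightarrow>
   (real \<Rightarrow> real \<Rightarrow> real) \<Rightarrow> (real \<Rightarrow> real \<Rightarrow> real) \<Rightarrow> bool" where
  "solves_system P \<gamma> T L S\<rho> Sv \<rho> v \<longleftrightarrow>
     (AE (t, x) in lebesgue_on (rect T L).
        \<exists>\<rho>t mx vt hx.
          ((\<lambda>s. \<rho> s x) has_real_derivative \<rho>t) (at t) \<and>
          (mass_flow \<rho> v t has_real_derivative mx) (at x) \<and>
          ((\<lambda>s. v s x) has_real_derivative vt) (at t) \<and>
          (enthalpy P \<rho> v t has_real_derivative hx) (at x) \<and>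
          \<rho>t + mx = S\<rho> t x \<and>
          vt + hx = - \<gamma> * \<bar>v t x\<bar> * v t x + Sv t x)"

definition original_system ::
  "(real \<Rightarrow> real) \<Rightarrow> real \<Rightarrow> real \<Rightarrow> real \<Rightarrow>
   (real \<Rightarrow> real \<Rightarrow> real) \<Rightarrow> (real \<Rightarrow> real \<Rightarrow> real) \<Rightarrow> bool" where
  "original_system P \<gamma> T L \<rho> v \<longleftrightarrow> solves_system P \<gamma> T L (\<lambda>t x. 0) (\<lambda>t x. 0) \<rho> v"

datatype measurement = Velocity_Measurement | Mass_Flow_Measurement

definition source_\<rho> :: "real \<Rightarrow> real \<Rightarrow> real" where
  "source_\<rho> t x = 0"

fun source_v ::
  "measurement \<Rightarrow> real \<Rightarrow> (real \<Rightarrow> real \<Rightarrow> real) \<Rightarrow> (real \<Rightarrow> real \<Rightarrow> real) \<Rightarrow>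
   (real \<Rightarrow> real \<Rightarrow> real) \<Rightarrow> (real \<Rightarrow> real \<Rightarrow> real) \<Rightarrow> real \<Rightarrow> real \<Rightarrow> real" where
  "source_v Velocity_Measurement \<mu> \<rho> v \<rho>h vh t x = \<mu> * (v t x - vh t x)"
| "source_v Mass_Flow_Measurement \<mu> \<rho> v \<rho>h vh t x =
     \<mu> * (mass_flow \<rho> v t x - mass_flow \<rho>h vh t x)"

definition observer_system ::
  "(real \<Rightarrow> real) \<Rightarrow> real \<Rightarrow> measurement \<Rightarrow> real \<Rightarrow> real \<Rightarrow> real \<Rightarrow>
   (real \<Rightarrow> real \<Rightarrow> real) \<Rightarrow> (real \<Rightarrow> real \<Rightarrow> real) \<Rightarrow>
   (real \<Rightarrow> real \<Rightarrow> real) \<Rightarrow> (real \<Rightarrow> real \<Rightarrow> real) \<Rightarrow> bool" where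
  "observer_system P \<gamma> meas \<mu> T L \<rho> v \<rho>h vh \<longleftrightarrow>
     solves_system P \<gamma> T L source_\<rho> (source_v meas \<mu> \<rho> v \<rho>h vh) \<rho>h vh"

text \<open>Every edge of a star starts in the inner node, so the traces there are those at \<open>x = 0\<close>.\<close>

definition coupling_conditions ::
  "('v, 'e) pre_digraph \<Rightarrow> (real \<Rightarrow> real) \<Rightarrow> real \<Rightarrow>
   ('e \<Rightarrow> real \<Rightarrow> real \<Rightarrow> real) \<Rightarrow> ('e \<Rightarrow> real \<Rightarrow> real \<Rightarrow> real) \<Rightarrow> bool" where
  "coupling_conditions G P T \<rho> v \<longleftrightarrow>
     (\<forall>t\<in>{0..T}.
        (\<Sum>e\<in>arcs G. mass_flow (\<rho> e) (v e) t 0) = 0 \<and>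
        (\<forall>e\<in>arcs G. \<forall>f\<in>arcs G. enthalpy P (\<rho> e) (v e) t 0 = enthalpy P (\<rho> f) (v f) t 0))"

text \<open>Every edge of a star ends in its boundary node, so the traces there are those at
  \<open>x = len e\<close>.\<close>

definition boundary_conditions ::
  "('v, 'e) pre_digraph \<Rightarrow> ('e \<Rightarrow> real) \<Rightarrow> real \<Rightarrow> ('e \<Rightarrow> real \<Rightarrow> 'v \<Rightarrow> real) \<Rightarrow>
   ('e \<Rightarrow> real \<Rightarrow> real \<Rightarrow> real) \<Rightarrow> ('e \<Rightarrow> real \<Rightarrow> real \<Rightarrow> real) \<Rightarrow> bool" where
  "boundary_conditions G len T mb \<rho> v \<longleftrightarrow>
     (\<forall>\<nu>\<in>boundary_nodes G. \<forall>e\<in>incident_edges G \<nu>. \<forall>t\<in>{0..T}.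
        mass_flow (\<rho> e) (v e) t (len e) = mb e t \<nu>)"

definition L2_dist_sq ::
  "('v, 'e) pre_digraph \<Rightarrow> ('e \<Rightarrow> real) \<Rightarrow> ('e \<Rightarrow> real \<Rightarrow> real) \<Rightarrow> ('e \<Rightarrow> real \<Rightarrow> real) \<Rightarrow>
   ('e \<Rightarrow> real \<Rightarrow> real) \<Rightarrow> ('e \<Rightarrow> real \<Rightarrow> real) \<Rightarrow> real" where
  "L2_dist_sq G len \<rho> v \<rho>h vh =
     (\<Sum>e\<in>arcs G. LINT x|lebesgue_on {0<..<len e}. (\<rho> e x - \<rho>h e x)\<^sup>2 + (v e x - vh e x)\<^sup>2)"

definition total_mass :: "('v, 'e) pre_digraph \<Rightarrow> ('e \<Rightarrow> real) \<Rightarrow> ('e \<Rightarrow> real \<Rightarrow> real) \<Rightarrow> real" where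
  "total_mass G len \<rho> = (\<Sum>e\<in>arcs G. LINT x|lebesgue_on {0<..<len e}. \<rho> e x)"

end

theory Submission
  imports Defs
begin

text \<open>
  Write \<open>d\<close> for the difference of original and observer, \<open>m\<close> for the mass flow and \<open>h\<close> for the
  enthalpy. The relative energy of the two states satisfies \<open>\<partial>\<^sub>t H + \<partial>\<^sub>x (dm dh) = s dm + r\<close>, where the
  source \<open>s\<close> (friction and measurement) damps \<open>dv\<close> and the remainder \<open>r\<close> is quadratic in the
  differences with a factor \<open>C\<^sub>t\<close>. To damp \<open>d\<rho>\<close> as well, subtract \<open>\<epsilon> dv R\<close> with
  \<open>R(x) = - \<integral>\<^sub>x\<^sup>l d\<rho>\<close>: since \<open>\<partial>\<^sub>x R = d\<rho>\<close> and \<open>\<partial>\<^sub>t R = - dm\<close>, this adds the dissipation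
  \<open>- \<epsilon> dh d\<rho>\<close> and the flux \<open>- \<epsilon> dh R\<close>. At the inner node \<open>dh\<close> is the same on all edges, the
  \<open>dm\<close> sum to zero and the \<open>R(0)\<close> sum to minus the conserved mass difference, so the boundary terms
  contribute at most a multiple of \<open>\<bar>\<Delta>M\<^sub>0\<bar>\<close>, and Gronwall's inequality concludes.

  As the equations hold almost everywhere only, all functionals are Lipschitz continuous in time and
  are differentiated at almost every time.
\<close>

section \<open>Lipschitz functions\<close>

text \<open>The term with the mass difference cannot be avoided: two rest states with different
  constant densities satisfy all equations and conditions, and their distance never decays. The
  relative energy is expanded at the original state so that its remainder contains time derivatives
  of the original solution only; this is why (A4) bounds \<open>\<rho>\<close> and \<open>v\<close>
  in time, but not the observer. The correction is nonlocal in \<open>x\<close>. Coercivity and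
  decay therefore hold only after integration over an edge, where the tail integral is bounded by
  the density difference. The constants are fixed in the order \<open>c0\<close>,
  \<open>\<epsilon>\<close>, \<open>\<eta>\<close>. The weight \<open>\<epsilon>\<close> must be
  small for the velocity damping and the relative energy to dominate the correction. The resulting
  density damping is itself proportional to \<open>\<epsilon>\<close>, so the smallness
  \<open>\<eta>\<close> of velocities and time derivatives has to be chosen last. None of them
  depends on \<open>T\<close> or on the solutions.\<close>

definition Lip :: "'a::metric_space set \<Rightarrow> ('a \<Rightarrow> real) \<Rightarrow> bool" where
  "Lip S f \<longleftrightarrow> (\<exists>K. K-lipschitz_on S f)"

lemma LipE:
  assumes "Lip S f"
  obtains K where "0 \<le> K" "K-lipschitz_on S f"
    "\<And>x y. x \<in> S \<Longrightarrow> y \<in> S \<Longrightarrow> \<bar>f x - f y\<bar> \<le> K * dist x y"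
proof -
  obtain K where K: "K-lipschitz_on S f" using assms unfolding Lip_def by blast
  show thesis
    by (rule that[OF lipschitz_on_nonneg[OF K] K]) (use lipschitz_onD[OF K] in \<open>simp add: dist_real_def\<close>)
qed

lemma LipI:
  assumes "\<And>x y. x \<in> S \<Longrightarrow> y \<in> S \<Longrightarrow> \<bar>f x - f y\<bar> \<le> K * dist x y"
  shows "Lip S f"
proof -
  have "(max K 0)-lipschitz_on S f"
  proof (rule lipschitz_onI)
    fix x y assume "x \<in> S" "y \<in> S"
    then have "\<bar>f x - f y\<bar> \<le> K * dist x y" by (rule assms)
    also have "\<dots> \<le> max K 0 * dist x y" by (intro mult_right_mono) auto
    finally show "dist (f x) (f y) \<le> max K 0 * dist x y" by (simp add: dist_real_def)
  qed simp
  then show ?thesis unfolding Lip_def by blast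
qed

lemma Lip_subset: "Lip S f \<Longrightarrow> R \<subseteq> S \<Longrightarrow> Lip R f"
  unfolding Lip_def using lipschitz_on_subset by blast

lemma Lip_continuous: "Lip S f \<Longrightarrow> continuous_on S f"
  unfolding Lip_def using lipschitz_on_continuous_on by blast

lemma Lip_const: "Lip S (\<lambda>x. c)"
  unfolding Lip_def using lipschitz_on_constant by blast

lemma Lip_add: "Lip S f \<Longrightarrow> Lip S g \<Longrightarrow> Lip S (\<lambda>x. f x + g x)"
  unfolding Lip_def using lipschitz_on_add by blast

lemma Lip_diff: "Lip S f \<Longrightarrow> Lip S g \<Longrightarrow> Lip S (\<lambda>x. f x - g x)"
  unfolding Lip_def using lipschitz_on_diff by blast

text \<open>Compactness bounds both factors; on an unbounded set a product of Lipschitz functions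
  can grow quadratically.\<close>

lemma Lip_mult:
  assumes "compact S" "Lip S f" "Lip S g"
  shows "Lip S (\<lambda>x. f x * g x)"
proof -
  obtain K where K: "0 \<le> K" "\<And>x y. x \<in> S \<Longrightarrow> y \<in> S \<Longrightarrow> \<bar>f x - f y\<bar> \<le> K * dist x y"
    using LipE[OF assms(2)] by metis
  obtain M where M: "0 \<le> M" "\<And>x y. x \<in> S \<Longrightarrow> y \<in> S \<Longrightarrow> \<bar>g x - g y\<bar> \<le> M * dist x y"
    using LipE[OF assms(3)] by metis
  obtain A where A: "\<And>x. x \<in> S \<Longrightarrow> \<bar>f x\<bar> \<le> A"
    using compact_imp_bounded[OF compact_continuous_image[OF Lip_continuous[OF assms(2)] assms(1)]]
    by (auto simp: bounded_iff)
  obtain B where B: "\<And>x. x \<in> S \<Longrightarrow> \<bar>g x\<bar> \<le> B"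
    using compact_imp_bounded[OF compact_continuous_image[OF Lip_continuous[OF assms(3)] assms(1)]]
    by (auto simp: bounded_iff)
  show ?thesis
  proof (rule LipI)
    fix x y assume xy: "x \<in> S" "y \<in> S"
    have "f x * g x - f y * g y = f x * (g x - g y) + (f x - f y) * g y"
      by (simp add: algebra_simps)
    also have "\<bar>\<dots>\<bar> \<le> \<bar>f x\<bar> * \<bar>g x - g y\<bar> + \<bar>f x - f y\<bar> * \<bar>g y\<bar>"
      by (metis abs_mult abs_triangle_ineq)
    also have "\<dots> \<le> A * (M * dist x y) + (K * dist x y) * B"
      using A[OF xy(1)] B[OF xy(2)] K(2)[OF xy] M(2)[OF xy]
      by (intro add_mono mult_mono) (use K(1) M(1) in auto)
    also have "\<dots> = (A * M + K * B) * dist x y" by (simp add: algebra_simps)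
    finally show "\<bar>f x * g x - f y * g y\<bar> \<le> (A * M + K * B) * dist x y" .
  qed
qed

lemma C1_imp_Lip:
  fixes g :: "real \<Rightarrow> real"
  assumes der: "\<And>x. x \<in> {a..b} \<Longrightarrow> (g has_real_derivative g' x) (at x)"
    and cont: "continuous_on {a..b} g'"
  shows "Lip {a..b} g"
proof -
  obtain B where B: "\<And>x. x \<in> {a..b} \<Longrightarrow> \<bar>g' x\<bar> \<le> B"
    using compact_imp_bounded[OF compact_continuous_image[OF cont compact_Icc]]
    unfolding bounded_iff by (metis imageI real_norm_def)
  show ?thesis
  proof (rule LipI)
    fix x y assume "x \<in> {a..b}" "y \<in> {a..b}"
    then show "\<bar>g x - g y\<bar> \<le> B * dist x y"
      using field_differentiable_bound[of "{a..b}" g g' B y x] B has_field_derivative_at_within[OF der]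
      by (simp add: dist_real_def abs_minus_commute)
  qed
qed

lemma Lip_compose:
  assumes "Lip S f" "Lip R g" "f ` S \<subseteq> R"
  shows "Lip S (\<lambda>x. g (f x))"
  using assms lipschitz_on_compose2[of _ S f _ g] lipschitz_on_subset[of _ R g "f ` S"]
  unfolding Lip_def by blast

lemma Lip_sum: "(\<And>i. i \<in> I \<Longrightarrow> Lip S (f i)) \<Longrightarrow> Lip S (\<lambda>x. \<Sum>i\<in>I. f i x)"
  by (induction I rule: infinite_finite_induct) (auto intro: Lip_const Lip_add)

text \<open>At the single time \<open>t\<close> the derivative is known for almost every
  \<open>x\<close> only, yet all difference quotients are bounded by \<open>K\<close>, so dominated
  convergence passes to the limit along every sequence of times. Integrability of \<open>g\<close>
  comes out of the same limit.\<close>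

lemma has_real_derivative_integral_AE:
  fixes w :: "real \<Rightarrow> real \<Rightarrow> real"
  assumes S: "open S" "t \<in> S"
    and lip: "\<And>s x. s \<in> S \<Longrightarrow> x \<in> {a..b} \<Longrightarrow> \<bar>w s x - w t x\<bar> \<le> K * \<bar>s - t\<bar>"
    and int: "\<And>s. s \<in> S \<Longrightarrow> w s integrable_on {a..b}"
    and der: "AE x in lebesgue. x \<in> {a<..<b} \<longrightarrow> ((\<lambda>s. w s x) has_real_derivative g x) (at t)"
  shows "g integrable_on {a..b}"
    and "((\<lambda>s. integral {a..b} (w s)) has_real_derivative integral {a..b} g) (at t)"
proof -
  obtain N0 where N0: "negligible N0"
    "{x. \<not> (x \<in> {a<..<b} \<longrightarrow> ((\<lambda>s. w s x) has_real_derivative g x) (at t))} \<subseteq> N0"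
    using der unfolding eventually_ae_filter_negligible by blast
  \<comment> \<open>The end points join the exceptional set because \<open>der\<close> speaks about
    the open interval.\<close>
  define N where "N = insert a (insert b N0)"
  define S' where "S' = {a..b} - N"
  have N: "negligible N" unfolding N_def using N0(1) by simp
  have derN: "((\<lambda>s. w s x) has_real_derivative g x) (at t)" if "x \<in> S'" for x
    proof -
    have "x \<notin> N0" "x \<in> {a<..<b}" using that unfolding S'_def N_def by auto
    then show ?thesis using N0(2) by blast
  qed
  have neg: "negligible (sym_diff S' {a..b})"
    unfolding S'_def by (rule negligible_subset[OF N]) auto
  have int_iff: "f integrable_on S' \<longleftrightarrow> f integrable_on {a..b}" for f :: "real \<Rightarrow> real"
    by (rule integrable_spike_set_eq[OF neg])
  have int_eq: "integral S' f = integral {a..b} f" for f :: "real \<Rightarrow> real"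
    by (rule integral_spike_set; rule negligible_subset[OF N]; auto simp: S'_def)
  have seq: "g integrable_on {a..b} \<and>
      (\<lambda>n. (integral {a..b} (w (X n)) - integral {a..b} (w t)) / (X n - t))
        \<longlonglongrightarrow> integral {a..b} g"
    if X: "\<And>n. X n \<in> S - {t}" "X \<longlonglongrightarrow> t" for X :: "nat \<Rightarrow> real"
  proof -
    define q where "q n x = (w (X n) x - w t x) / (X n - t)" for n x
    have qint: "q n integrable_on {a..b}" for n
      unfolding q_def using X(1)[of n] int[of "X n"] int[OF S(2)]
      by (auto intro!: integrable_diff integrable_on_divide)
    have bound: "norm (q n x) \<le> K" if "x \<in> S'" for n x
    proof -
      have "x \<in> {a..b}" using that by (auto simp: S'_def)
      from lip[OF _ this, of "X n"] X(1)[of n] show ?thesis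
        by (simp add: q_def pos_divide_le_eq)
    qed
    have lim: "(\<lambda>n. q n x) \<longlonglongrightarrow> g x" if "x \<in> S'" for x
      using derN[OF that] X unfolding q_def has_field_derivative_iff tendsto_at_iff_sequentially
      by (auto simp: o_def)
    have "q n integrable_on S'" for n using qint int_iff by blast
    moreover have "(\<lambda>x. K) integrable_on S'" unfolding int_iff by (rule integrable_const_ivl)
    ultimately have "g integrable_on S'" "(\<lambda>n. integral S' (q n)) \<longlonglongrightarrow> integral S' g"
      using dominated_convergence[of q S' "\<lambda>_. K" g] bound lim by auto
    moreover have "integral S' (q n) =
        (integral {a..b} (w (X n)) - integral {a..b} (w t)) / (X n - t)" for n
      unfolding int_eq q_def using X(1)[of n] int[of "X n"] int[OF S(2)]
      by (simp add: integral_diff)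
    ultimately show ?thesis unfolding int_iff int_eq by simp
  qed
  \<comment> \<open>Integrability of \<open>g\<close> is a by-product of any admissible sequence, so
    one that tends to \<open>t\<close> inside \<open>S\<close> without hitting \<open>t\<close> has
    to be exhibited.\<close>
  obtain r where r: "r > 0" "cball t r \<subseteq> S" using S open_contains_cball by metis
  have "(\<lambda>n. t + r / real (Suc n)) \<longlonglongrightarrow> t + 0"
    by (intro tendsto_add tendsto_const LIMSEQ_Suc[OF lim_const_over_n])
  then have "(\<lambda>n. t + r / real (Suc n)) \<longlonglongrightarrow> t" by simp
  moreover have "t + r / real (Suc n) \<in> S - {t}" for n
    using r by (auto intro!: subsetD[OF r(2)] simp: dist_real_def field_simps)
  ultimately show "g integrable_on {a..b}"
    using seq[of "\<lambda>n. t + r / real (Suc n)"] by blast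
  have "((\<lambda>y. (integral {a..b} (w y) - integral {a..b} (w t)) / (y - t)) \<longlongrightarrow> integral {a..b} g)
      (at t within S)"
    unfolding tendsto_at_iff_sequentially using seq by (auto simp: o_def)
  then show "((\<lambda>s. integral {a..b} (w s)) has_real_derivative integral {a..b} g) (at t)"
    unfolding has_field_derivative_iff using S by (metis at_within_open)
qed

text \<open>With \<open>f\<close> extended by constants, \<open>\<integral>\<^sub>a\<^sup>b f (x + s) dx\<close> is differentiated at \<open>s = 0\<close> in two ways:
  under the integral and, after a shift, through its limits.\<close>

lemma lipschitz_FTC:
  fixes f g :: "real \<Rightarrow> real"
  assumes "a \<le> b" and "Lip {a..b} f"
    and der: "AE x in lebesgue. x \<in> {a<..<b} \<longrightarrow> (f has_real_derivative g x) (at x)"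
  shows "(g has_integral (f b - f a)) {a..b}"
proof -
  obtain K where lip: "K-lipschitz_on {a..b} f" using assms(2) by (elim LipE)
  \<comment> \<open>Clamping the argument to \<open>{a..b}\<close> keeps the Lipschitz constant and
    gives \<open>f (x + s)\<close> a meaning beyond the end points.\<close>
  define F where "F y = f (max a (min b y))" for y
  have Flip: "\<bar>F x - F y\<bar> \<le> K * \<bar>x - y\<bar>" for x y
  proof -
    have "\<bar>F x - F y\<bar> \<le> K * \<bar>max a (min b x) - max a (min b y)\<bar>"
      unfolding F_def using lipschitz_onD[OF lip, of "max a (min b x)" "max a (min b y)"] \<open>a \<le> b\<close>
      by (auto simp: dist_real_def)
    also have "\<dots> \<le> K * \<bar>x - y\<bar>"
      using lipschitz_on_nonneg[OF lip] by (intro mult_left_mono) (auto simp: max_def min_def abs_if)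
    finally show ?thesis .
  qed
  then have "K-lipschitz_on UNIV F"
    using lipschitz_on_nonneg[OF lip] by (auto intro!: lipschitz_onI simp: dist_real_def)
  then have Fcont: "continuous_on UNIV F" by (rule lipschitz_on_continuous_on)
  have shift: "integral {a..b} (\<lambda>x. F (x + s)) = integral {a + s..b + s} F" for s
    using integral_shift_Icc_real[of a b F s] by (simp only: o_def add.commute[of s])
  have "AE x in lebesgue. x \<in> {a<..<b} \<longrightarrow> ((\<lambda>s. F (x + s)) has_real_derivative g x) (at 0)"
    using der
  proof (eventually_elim, intro impI)
    fix x assume h: "x \<in> {a<..<b} \<longrightarrow> (f has_real_derivative g x) (at x)" and x: "x \<in> {a<..<b}"
    have "eventually (\<lambda>y. y \<in> {a<..<b}) (nhds x)"
      using x by (intro eventually_nhds_in_open) auto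
    then have "eventually (\<lambda>y. F y = f y) (nhds x)"
      by eventually_elim (auto simp: F_def)
    then have "(F has_real_derivative g x) (at x)"
      using h x DERIV_cong_ev[OF refl _ refl] by blast
    then show "((\<lambda>s. F (x + s)) has_real_derivative g x) (at 0)"
      using DERIV_shift[of F "g x" 0 x] by (simp add: add.commute)
  qed
  note * = has_real_derivative_integral_AE[where w = "\<lambda>s x. F (x + s)" and S = UNIV and K = K,
      OF _ _ _ _ this, unfolded shift]
  have h1: "\<bar>F (x + s) - F (x + 0)\<bar> \<le> K * \<bar>s - 0\<bar>" for x s
    using Flip[of "x + s" x] by simp
  have h2: "(\<lambda>x. F (x + s)) integrable_on {a..b}" for s
    by (intro integrable_continuous_interval continuous_on_compose2[OF Fcont] continuous_intros) auto
  have g: "g integrable_on {a..b}" by (rule *(1)) (simp_all only: h1 h2 open_UNIV UNIV_I)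
  have d1: "((\<lambda>s. integral {a + s..b + s} F) has_real_derivative integral {a..b} g) (at 0)"
    by (rule *(2)) (simp_all only: h1 h2 open_UNIV UNIV_I)
  \<comment> \<open>The fixed lower limit \<open>a - 1\<close> turns the moving window into a
    difference of two primitives; it stays to the left of the window as long as the shift is below
    one in absolute value.\<close>
  have G: "((\<lambda>s. integral {a - 1..c + s} F) has_real_derivative F c) (at 0)" if "a \<le> c" for c
  proof -
    have "((\<lambda>u. integral {a - 1..u} F) has_real_derivative F c) (at c within {a - 1..c + 1})"
    proof (rule integral_has_real_derivative)
      show "continuous_on {a - 1..c + 1} F" using Fcont by (rule continuous_on_subset) simp
      show "c \<in> {a - 1..c + 1}" using that by simp
    qed
    then have "((\<lambda>u. integral {a - 1..u} F) has_real_derivative F c) (at c)"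
      using at_within_Icc_at[of "a - 1" c "c + 1"] that by simp
    then show ?thesis using DERIV_shift[of "\<lambda>u. integral {a - 1..u} F" "F c" 0 c] by (simp add: add.commute)
  qed
  have "((\<lambda>s. integral {a - 1..b + s} F - integral {a - 1..a + s} F) has_real_derivative F b - F a) (at 0)"
    using \<open>a \<le> b\<close> by (intro DERIV_diff G) auto
  then have "((\<lambda>s. integral {a + s..b + s} F) has_real_derivative F b - F a) (at 0)"
  proof (rule DERIV_cong_ev[OF refl _ refl, THEN iffD1, rotated])
    show "eventually (\<lambda>s. integral {a - 1..b + s} F - integral {a - 1..a + s} F
      = integral {a + s..b + s} F) (nhds (0::real))"
  proof -
    have "eventually (\<lambda>s. s \<in> {-1<..<1}) (nhds (0::real))"
      by (intro eventually_nhds_in_open) auto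
    then show ?thesis
    proof eventually_elim
      case (elim s)
      have "integral {a - 1..a + s} F + integral {a + s..b + s} F = integral {a - 1..b + s} F"
        using elim \<open>a \<le> b\<close>
        by (intro Henstock_Kurzweil_Integration.integral_combine integrable_continuous_interval
            continuous_on_subset[OF Fcont]) auto
      then show ?case by simp
    qed
  qed
  qed
  with d1 have "integral {a..b} g = F b - F a" by (rule DERIV_unique)
  also have "\<dots> = f b - f a" using \<open>a \<le> b\<close> by (simp add: F_def)
  finally show ?thesis using g by (metis has_integral_integral)
qed

text \<open>With the integrating factor \<open>exp (c * s)\<close>, the shifted function
  \<open>y - k / c\<close> gets a derivative that is nonpositive almost everywhere. A Lipschitz
  function is the integral of its derivative, which turns this into a comparison of values.\<close>

lemma lipschitz_gronwall:
  fixes y :: "real \<Rightarrow> real"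
  assumes lip: "Lip {0..T} y" and c: "c > 0" and t: "t \<in> {0..T}"
    and der: "AE s in lebesgue. s \<in> {0<..<T} \<longrightarrow>
      (\<exists>D. (y has_real_derivative D) (at s) \<and> D \<le> k - c * y s)"
  shows "y t \<le> (y 0 - k / c) * exp (- c * t) + k / c"
proof -
  define z where "z s = exp (c * s) * (y s - k / c)" for s
  have t0: "0 \<le> t" "t \<le> T" using t by auto
  have "Lip {0..t} (\<lambda>s. exp (c * s))"
  proof (rule C1_imp_Lip)
    show "((\<lambda>s. exp (c * s)) has_real_derivative exp (c * s) * c) (at s)" for s
      by (auto intro!: derivative_eq_intros)
  qed (intro continuous_intros)
  then have L: "Lip {0..t} z"
    unfolding z_def using t0 by (intro Lip_mult Lip_diff Lip_const Lip_subset[OF lip]) auto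
  \<comment> \<open>The choice is arbitrary on the exceptional set; integrability of the function
    \<open>g\<close> built from \<open>D\<close> is delivered by
    \<open>lipschitz_FTC\<close>.\<close>
  obtain D where D: "AE s in lebesgue. s \<in> {0<..<T} \<longrightarrow> (y has_real_derivative D s) (at s) \<and> D s \<le> k - c * y s"
    using der by (rule that[of "\<lambda>s. SOME D. (y has_real_derivative D) (at s) \<and> D \<le> k - c * y s", OF eventually_mono]) (metis (mono_tags, lifting) someI_ex)
  define g where "g s = exp (c * s) * (D s + c * y s - k)" for s
  have "AE s in lebesgue. s \<in> {0<..<t} \<longrightarrow> (z has_real_derivative g s) (at s)"
    using D
  proof (eventually_elim, intro impI)
    fix s assume "s \<in> {0<..<T} \<longrightarrow> (y has_real_derivative D s) (at s) \<and> D s \<le> k - c * y s" "s \<in> {0<..<t}"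
    then have "(y has_real_derivative D s) (at s)" using t0 by auto
    then show "(z has_real_derivative g s) (at s)"
      unfolding z_def g_def using c by (auto intro!: derivative_eq_intros simp: field_simps)
  qed
  then have zg: "(g has_integral (z t - z 0)) {0..t}" by (rule lipschitz_FTC[OF t0(1) L])
  have "AE s in lebesgue. s \<in> {0<..<t} \<longrightarrow> g s \<le> 0"
    using D by eventually_elim (use t0 in \<open>auto simp: g_def mult_le_0_iff\<close>)
  then obtain N where N: "negligible N" "{s. \<not> (s \<in> {0<..<t} \<longrightarrow> g s \<le> 0)} \<subseteq> N"
    unfolding eventually_ae_filter_negligible by metis
  have "negligible (insert 0 (insert t N))" using N(1) by simp
  then have "((\<lambda>s. if s \<in> insert 0 (insert t N) then 0 else g s) has_integral (z t - z 0)) {0..t}"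
    by (rule has_integral_spike[OF _ _ zg]) simp
  then have "z t - z 0 \<le> 0"
    by (rule has_integral_le[OF _ has_integral_0]) (use N(2) in \<open>auto simp: subset_iff less_le\<close>)
  then have "y t - k / c \<le> (y 0 - k / c) / exp (c * t)"
    by (simp add: z_def field_simps)
  then show ?thesis by (simp add: exp_minus divide_inverse mult.commute)
qed

section \<open>Balance laws on a rectangle\<close>

lemma Lip_slice:
  assumes "Lip (A \<times> B) (\<lambda>(t, x). f t x)" "t \<in> A"
  shows "Lip B (f t)"
proof -
  obtain K where "\<And>z w. z \<in> A \<times> B \<Longrightarrow> w \<in> A \<times> B \<Longrightarrow>
      \<bar>(\<lambda>(t, x). f t x) z - (\<lambda>(t, x). f t x) w\<bar> \<le> K * dist z w"
    using LipE[OF assms(1)] by metis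
  from this[of "(t, _)" "(t, _)"] assms(2) show ?thesis
    by (intro LipI[where K = K]) (auto simp: dist_Pair_Pair)
qed

lemma Lip_slice2:
  assumes "Lip (A \<times> B) (\<lambda>(t, x). f t x)" "x \<in> B"
  shows "Lip A (\<lambda>t. f t x)"
proof -
  obtain K where "\<And>z w. z \<in> A \<times> B \<Longrightarrow> w \<in> A \<times> B \<Longrightarrow>
      \<bar>(\<lambda>(t, x). f t x) z - (\<lambda>(t, x). f t x) w\<bar> \<le> K * dist z w"
    using LipE[OF assms(1)] by metis
  from this[of "(_, x)" "(_, x)"] assms(2) show ?thesis
    by (intro LipI[where K = K]) (auto simp: dist_Pair_Pair)
qed

lemma has_real_derivative_tail_integral:
  fixes f :: "real \<Rightarrow> real"
  assumes "continuous_on {a..b} f" "x \<in> {a<..<b}"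
  shows "((\<lambda>x. integral {x..b} f) has_real_derivative - f x) (at x)"
proof -
  have "((\<lambda>u. integral {a..u} f) has_real_derivative f x) (at x within {a..b})"
    by (rule integral_has_real_derivative) (use assms in auto)
  then have "((\<lambda>u. integral {a..b} f - integral {a..u} f) has_real_derivative 0 - f x) (at x)"
    using assms(2) at_within_Icc_at[of a x b] by (intro DERIV_diff) auto
  then have "((\<lambda>u. integral {a..b} f - integral {a..u} f) has_real_derivative - f x) (at x)"
    by simp
  then show ?thesis
  proof (rule DERIV_cong_ev[OF refl _ refl, THEN iffD1, rotated])
    have "eventually (\<lambda>u. u \<in> {a<..<b}) (nhds x)"
      using assms(2) by (intro eventually_nhds_in_open) auto
    then show "\<forall>\<^sub>F u in nhds x. integral {a..b} f - integral {a..u} f = integral {u..b} f"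
    proof eventually_elim
      case (elim u)
      have "integral {a..u} f + integral {u..b} f = integral {a..b} f"
        using elim by (intro Henstock_Kurzweil_Integration.integral_combine
            integrable_continuous_interval[OF assms(1)]) auto
      then show ?case by simp
    qed
  qed
qed

text \<open>A time increment costs the Lipschitz constant times the length of the edge, a space
  increment costs the supremum of \<open>f\<close>. The lemma serves for \<open>R\<close> and, with
  \<open>x = 0\<close>, for the time regularity of every integral over a whole edge.\<close>

lemma Lip_tail_integral:
  fixes f :: "real \<Rightarrow> real \<Rightarrow> real"
  assumes f: "Lip ({0..T} \<times> {0..L}) (\<lambda>(t, x). f t x)"
  shows "Lip ({0..T} \<times> {0..L}) (\<lambda>(t, x). integral {x..L} (f t))"
proof -
  obtain K where K: "0 \<le> K" "\<And>z w. z \<in> {0..T} \<times> {0..L} \<Longrightarrow> w \<in> {0..T} \<times> {0..L} \<Longrightarrow>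
      \<bar>(\<lambda>(t, x). f t x) z - (\<lambda>(t, x). f t x) w\<bar> \<le> K * dist z w"
    using LipE[OF f] by metis
  obtain B where B0: "\<And>z. z \<in> {0..T} \<times> {0..L} \<Longrightarrow> \<bar>(\<lambda>(t, x). f t x) z\<bar> \<le> B"
    using compact_imp_bounded[OF compact_continuous_image[OF Lip_continuous[OF f] compact_Times[OF compact_Icc compact_Icc]]]
    unfolding bounded_iff by (metis imageI real_norm_def)
  have B: "\<bar>f t x\<bar> \<le> B" if "t \<in> {0..T}" "x \<in> {0..L}" for t x
    using B0[of "(t, x)"] that by simp
  have cont: "continuous_on {0..L} (f t)" if "t \<in> {0..T}" for t
    using Lip_continuous[OF Lip_slice[OF f that]] .
  have int: "f t integrable_on {x..y}" if "t \<in> {0..T}" "0 \<le> x" "y \<le> L" for t x y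
    using cont[OF that(1)] by (rule integrable_continuous_interval[OF continuous_on_subset]) (use that in auto)
  have time: "\<bar>integral {x..L} (f t) - integral {x..L} (f s)\<bar> \<le> K * \<bar>t - s\<bar> * L"
    if "t \<in> {0..T}" "s \<in> {0..T}" "x \<in> {0..L}" for t s x
  proof -
    have "norm (integral {x..L} (\<lambda>y. f t y - f s y)) \<le> integral {x..L} (\<lambda>_. K * \<bar>t - s\<bar>)"
    proof (rule integral_norm_bound_integral)
      show "norm (f t y - f s y) \<le> K * \<bar>t - s\<bar>" if "y \<in> {x..L}" for y
        using K(2)[of "(t, y)" "(s, y)"] that \<open>t \<in> _\<close> \<open>s \<in> _\<close> \<open>x \<in> _\<close>
        by (simp add: dist_Pair_Pair dist_real_def)
    qed (use that int in \<open>auto intro!: integrable_diff\<close>)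
    also have "\<dots> = K * \<bar>t - s\<bar> * (L - x)"
      using that by simp
    also have "\<dots> \<le> K * \<bar>t - s\<bar> * L"
      using that K(1) by (intro mult_left_mono) auto
    finally show ?thesis
      using that int by (simp add: integral_diff)
  qed
  have space: "\<bar>integral {x..L} (f t) - integral {y..L} (f t)\<bar> \<le> B * \<bar>x - y\<bar>"
    if "t \<in> {0..T}" "x \<in> {0..L}" "y \<in> {0..L}" "x \<le> y" for t x y
  proof -
    have "integral {x..y} (f t) + integral {y..L} (f t) = integral {x..L} (f t)"
      by (rule Henstock_Kurzweil_Integration.integral_combine) (use that int in auto)
    moreover have "norm (integral {x..y} (f t)) \<le> integral {x..y} (\<lambda>_. B)"
      by (rule integral_norm_bound_integral) (use that int B in auto)
    ultimately show ?thesis using that by (simp add: mult.commute)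
  qed
  have space': "\<bar>integral {x..L} (f t) - integral {y..L} (f t)\<bar> \<le> B * \<bar>x - y\<bar>"
    if "t \<in> {0..T}" "x \<in> {0..L}" "y \<in> {0..L}" for t x y
    using space[of t x y] space[of t y x] that by (cases "x \<le> y") (auto simp: abs_minus_commute)
  show ?thesis
  proof (rule LipI)
    fix z w assume "z \<in> {0..T} \<times> {0..L}" "w \<in> {0..T} \<times> {0..L}"
    then obtain t x s y where zw: "z = (t, x)" "w = (s, y)"
      and m: "t \<in> {0..T}" "x \<in> {0..L}" "s \<in> {0..T}" "y \<in> {0..L}" by auto
    have B0: "0 \<le> B" using B[of t x] m by auto
    have d: "\<bar>t - s\<bar> \<le> dist z w" "\<bar>x - y\<bar> \<le> dist z w"
      unfolding zw using dist_fst_le[of "(t, x)" "(s, y)"] dist_snd_le[of "(t, x)" "(s, y)"]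
      by (auto simp: dist_real_def)
    have "\<bar>integral {x..L} (f t) - integral {y..L} (f s)\<bar> \<le> K * \<bar>t - s\<bar> * L + B * \<bar>x - y\<bar>"
      using time[of t s x] space'[of s x y] m by linarith
    also have "\<dots> \<le> K * dist z w * L + B * dist z w"
      using d m K(1) B0 by (intro add_mono mult_mono mult_nonneg_nonneg) auto
    finally show "\<bar>(\<lambda>(t, x). integral {x..L} (f t)) z - (\<lambda>(t, x). integral {x..L} (f t)) w\<bar>
        \<le> (K * L + B) * dist z w"
      unfolding zw by (simp add: algebra_simps)
  qed
qed

lemma integral_le_AE:
  fixes f g :: "real \<Rightarrow> real"
  assumes "f integrable_on {a..b}" "g integrable_on {a..b}"
    and "AE x in lebesgue. x \<in> {a<..<b} \<longrightarrow> f x \<le> g x"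
  shows "integral {a..b} f \<le> integral {a..b} g"
proof -
  obtain N where N: "negligible N" "{x. \<not> (x \<in> {a<..<b} \<longrightarrow> f x \<le> g x)} \<subseteq> N"
    using assms(3) unfolding eventually_ae_filter_negligible by metis
  have neg: "negligible (insert a (insert b N))" using N(1) by simp
  have "((\<lambda>x. if x \<in> insert a (insert b N) then g x else f x) has_integral integral {a..b} f) {a..b}"
    by (rule has_integral_spike[OF neg _ integrable_integral[OF assms(1)]]) simp
  then show ?thesis
    by (rule has_integral_le[OF _ integrable_integral[OF assms(2)]])
      (use N(2) in \<open>auto simp: subset_iff less_le\<close>)
qed

text \<open>The differential inequality is integrated over \<open>{a..L}\<close> at one fixed time:
  the time derivative moves out of the integral by dominated convergence, and the flux derivative
  integrates to its boundary values because \<open>b\<close> is Lipschitz.\<close>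

lemma balance_inequality:
  fixes w :: "real \<Rightarrow> real \<Rightarrow> real"
  assumes t: "t \<in> {0<..<T}" and a: "a \<in> {0..L}"
    and w: "Lip ({0..T} \<times> {0..L}) (\<lambda>(t, x). w t x)"
    and b: "Lip {0..L} b" and q: "continuous_on {0..L} q"
    and le: "AE x in lebesgue. x \<in> {0<..<L} \<longrightarrow> (\<exists>wt bx. ((\<lambda>s. w s x) has_real_derivative wt) (at t) \<and>
      (b has_real_derivative bx) (at x) \<and> wt + bx \<le> q x)"
  shows "\<exists>D. ((\<lambda>s. integral {a..L} (w s)) has_real_derivative D) (at t) \<and>
    D \<le> integral {a..L} q + b a - b L"
proof -
  \<comment> \<open>The witnesses in \<open>le\<close> depend on \<open>x\<close>;
    \<open>deriv\<close> makes them functions of \<open>x\<close> that can be integrated.\<close>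
  define g where "g x = deriv (\<lambda>s. w s x) t" for x
  have le': "AE x in lebesgue. x \<in> {a<..<L} \<longrightarrow> ((\<lambda>s. w s x) has_real_derivative g x) (at t) \<and>
      (b has_real_derivative deriv b x) (at x) \<and> g x \<le> q x - deriv b x"
    using le
  proof (eventually_elim, intro impI)
    fix x assume "x \<in> {0<..<L} \<longrightarrow> (\<exists>wt bx. ((\<lambda>s. w s x) has_real_derivative wt) (at t) \<and>
      (b has_real_derivative bx) (at x) \<and> wt + bx \<le> q x)" "x \<in> {a<..<L}"
    then obtain wt bx where "((\<lambda>s. w s x) has_real_derivative wt) (at t)"
      "(b has_real_derivative bx) (at x)" "wt + bx \<le> q x" using a by auto
    moreover from this have "g x = wt" "deriv b x = bx"
      unfolding g_def by (auto intro: DERIV_imp_deriv)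
    ultimately show "((\<lambda>s. w s x) has_real_derivative g x) (at t) \<and>
      (b has_real_derivative deriv b x) (at x) \<and> g x \<le> q x - deriv b x" by simp
  qed
  obtain K where K: "\<And>z w'. z \<in> {0..T} \<times> {0..L} \<Longrightarrow> w' \<in> {0..T} \<times> {0..L} \<Longrightarrow>
      \<bar>(\<lambda>(t, x). w t x) z - (\<lambda>(t, x). w t x) w'\<bar> \<le> K * dist z w'"
    using LipE[OF w] by metis
  have lip: "\<bar>w s x - w t x\<bar> \<le> K * \<bar>s - t\<bar>" if "s \<in> {0<..<T}" "x \<in> {a..L}" for s x
    using K[of "(s, x)" "(t, x)"] that t a by (simp add: dist_Pair_Pair dist_real_def)
  have wint: "w s integrable_on {a..L}" if "s \<in> {0<..<T}" for s
    by (intro integrable_continuous_interval continuous_on_subset[OF Lip_continuous[OF Lip_slice[OF w]]])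
      (use that a in auto)
  have der: "AE x in lebesgue. x \<in> {a<..<L} \<longrightarrow> ((\<lambda>s. w s x) has_real_derivative g x) (at t)"
    using le' by eventually_elim blast
  note * = has_real_derivative_integral_AE[OF open_greaterThanLessThan t lip wint der]
  have "AE x in lebesgue. x \<in> {a<..<L} \<longrightarrow> (b has_real_derivative deriv b x) (at x)"
    using le' by eventually_elim blast
  then have bi: "(deriv b has_integral (b L - b a)) {a..L}"
    using a by (intro lipschitz_FTC Lip_subset[OF b]) auto
  have qi: "q integrable_on {a..L}"
    by (intro integrable_continuous_interval continuous_on_subset[OF q]) (use a in auto)
  have "integral {a..L} g \<le> integral {a..L} (\<lambda>x. q x - deriv b x)"
  proof (rule integral_le_AE)
    show "AE x in lebesgue. x \<in> {a<..<L} \<longrightarrow> g x \<le> q x - deriv b x"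
      using le' by eventually_elim blast
  qed (use *(1) qi bi in \<open>auto intro!: integrable_diff\<close>)
  also have "\<dots> = integral {a..L} q + b a - b L"
    using qi bi by (simp add: integral_diff has_integral_iff)
  finally show ?thesis using *(2) by blast
qed

text \<open>The inequality is applied to \<open>(w, b)\<close> and to \<open>(- w, - b)\<close>;
  uniqueness of the derivative joins the two one-sided bounds.\<close>

lemma balance_equation:
  fixes w :: "real \<Rightarrow> real \<Rightarrow> real"
  assumes t: "t \<in> {0<..<T}" and a: "a \<in> {0..L}"
    and w: "Lip ({0..T} \<times> {0..L}) (\<lambda>(t, x). w t x)" and b: "Lip {0..L} b"
    and eq: "AE x in lebesgue. x \<in> {0<..<L} \<longrightarrow> (\<exists>wt bx. ((\<lambda>s. w s x) has_real_derivative wt) (at t) \<and>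
      (b has_real_derivative bx) (at x) \<and> wt + bx = 0)"
  shows "((\<lambda>s. integral {a..L} (w s)) has_real_derivative b a - b L) (at t)"
proof -
  have "\<exists>D. ((\<lambda>s. integral {a..L} (w s)) has_real_derivative D) (at t) \<and>
    D \<le> integral {a..L} (\<lambda>x. 0) + b a - b L"
    by (rule balance_inequality[OF t a w b]) (use eq in \<open>auto elim!: eventually_mono\<close>, fastforce)
  then obtain D where D: "((\<lambda>s. integral {a..L} (w s)) has_real_derivative D) (at t)" "D \<le> b a - b L"
    by auto
  have w': "Lip ({0..T} \<times> {0..L}) (\<lambda>(t, x). - w t x)"
    using Lip_diff[OF Lip_const[of _ 0] w] by (simp add: case_prod_unfold)
  have b': "Lip {0..L} (\<lambda>x. - b x)"
    using Lip_diff[OF Lip_const[of _ 0] b] by simp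
  have "\<exists>D. ((\<lambda>s. integral {a..L} (\<lambda>x. - w s x)) has_real_derivative D) (at t) \<and>
    D \<le> integral {a..L} (\<lambda>x. 0) + - b a - - b L"
  proof (rule balance_inequality[OF t a w' b'])
    show "AE x in lebesgue. x \<in> {0<..<L} \<longrightarrow> (\<exists>wt bx. ((\<lambda>s. - w s x) has_real_derivative wt) (at t) \<and>
      ((\<lambda>x. - b x) has_real_derivative bx) (at x) \<and> wt + bx \<le> 0)"
      using eq
    proof (eventually_elim, intro impI)
      fix x assume "x \<in> {0<..<L} \<longrightarrow> (\<exists>wt bx. ((\<lambda>s. w s x) has_real_derivative wt) (at t) \<and>
        (b has_real_derivative bx) (at x) \<and> wt + bx = 0)" "x \<in> {0<..<L}"
      then obtain wt bx where "((\<lambda>s. w s x) has_real_derivative wt) (at t)"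
        "(b has_real_derivative bx) (at x)" "wt + bx = 0" by blast
      then show "\<exists>wt bx. ((\<lambda>s. - w s x) has_real_derivative wt) (at t) \<and>
        ((\<lambda>x. - b x) has_real_derivative bx) (at x) \<and> wt + bx \<le> 0"
        by (intro exI[of _ "- wt"] exI[of _ "- bx"]) (auto intro: DERIV_minus)
    qed
  qed simp
  then obtain D' where D': "((\<lambda>s. - integral {a..L} (w s)) has_real_derivative D') (at t)"
    "D' \<le> b L - b a" by auto
  from DERIV_unique[OF D'(1) DERIV_minus[OF D(1)]] D(2) D'(2) have "D = b a - b L" by simp
  with D(1) show ?thesis by simp
qed

text \<open>Lebesgue measure in the plane is the completion of a product measure and not itself a
  product of completions. Null sets are therefore passed to \<open>lborel\<close>, split there by
  Fubini, and passed back in each variable.\<close>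

lemma AE_rect_iterated:
  fixes T L :: real
  assumes "AE z in lebesgue_on ({0<..<T} \<times> {0<..<L}). Q z"
  shows "AE t in lebesgue. t \<in> {0<..<T} \<longrightarrow> (AE x in lebesgue. x \<in> {0<..<L} \<longrightarrow> Q (t, x))"
proof -
  have "{0<..<T} \<times> {0<..<L} \<in> sets lebesgue"
    by (intro sets_completionI_sets) (simp add: borel_open open_Times)
  then have "AE z in lebesgue. z \<in> {0<..<T} \<times> {0<..<L} \<longrightarrow> Q z"
    using assms by (simp add: AE_restrict_space_iff)
  then have "AE z in lborel \<Otimes>\<^sub>M lborel. z \<in> {0<..<T} \<times> {0<..<L} \<longrightarrow> Q z"
    unfolding AE_completion_iff lborel_prod .
  then have "AE t in lborel. AE x in lborel. (t, x) \<in> {0<..<T} \<times> {0<..<L} \<longrightarrow> Q (t, x)"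
    by (rule lborel_pair.AE_pair)
  then have "AE t in lebesgue. AE x in lborel. (t, x) \<in> {0<..<T} \<times> {0<..<L} \<longrightarrow> Q (t, x)"
    by (rule AE_completion)
  then show ?thesis
  proof (eventually_elim, intro impI)
    fix t assume "AE x in lborel. (t, x) \<in> {0<..<T} \<times> {0<..<L} \<longrightarrow> Q (t, x)" "t \<in> {0<..<T}"
    then show "AE x in lebesgue. x \<in> {0<..<L} \<longrightarrow> Q (t, x)"
      by (auto dest!: AE_completion)
  qed
qed

text \<open>The set where the bound fails inside the rectangle is open and negligible, hence empty,
  and continuity extends the bound to the closure. This makes the essential velocity bounds
  available at the end points of an edge.\<close>

lemma continuous_AE_bound:
  fixes f :: "real \<times> real \<Rightarrow> real"
  assumes TL: "0 < T" "0 < L" and f: "continuous_on ({0..T} \<times> {0..L}) f"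
    and ae: "AE z in lebesgue_on ({0<..<T} \<times> {0<..<L}). f z \<le> c" and z: "z \<in> {0..T} \<times> {0..L}"
  shows "f z \<le> c"
proof -
  let ?U = "{0<..<T} \<times> {0<..<L}"
  have cl: "closure ?U = {0..T} \<times> {0..L}" using TL by (simp add: closure_Times)
  have oU: "open ?U" by (intro open_Times) auto
  have "open (?U \<inter> f -` {c<..})"
    by (rule continuous_open_preimage[OF continuous_on_subset[OF f] oU]) auto
  moreover have "?U \<in> sets lebesgue"
    using oU by (intro sets_completionI_sets) simp
  then have "AE z in lebesgue. z \<in> ?U \<longrightarrow> f z \<le> c"
    using ae by (simp add: AE_restrict_space_iff)
  then obtain N where N: "negligible N" "{z. \<not> (z \<in> ?U \<longrightarrow> f z \<le> c)} \<subseteq> N"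
    unfolding eventually_ae_filter_negligible by metis
  have "negligible (?U \<inter> f -` {c<..})"
    by (rule negligible_subset[OF N(1)]) (use N(2) in \<open>fastforce simp: subset_iff\<close>)
  ultimately have "?U \<inter> f -` {c<..} = {}" using open_not_negligible by blast
  then have "f x \<le> c" if "x \<in> ?U" for x using that by fastforce
  then show ?thesis
    using continuous_le_on_closure[of ?U f z c] f z unfolding cl by blast
qed

text \<open>A Poincare-type inequality, obtained from Cauchy-Schwarz; it allows \<open>R\<close> to
  be absorbed by the damping of the density difference.\<close>

lemma tail_integral_square:
  fixes f :: "real \<Rightarrow> real"
  assumes f: "continuous_on {0..l} f" and x: "x \<in> {0..l}"
  shows "(integral {x..l} f)\<^sup>2 \<le> l * integral {0..l} (\<lambda>y. (f y)\<^sup>2)"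
proof (cases "l = 0")
  case True
  then show ?thesis using x by simp
next
  case False
  then have l: "0 < l" using x by auto
  have fx: "continuous_on {x..l} f" using f by (rule continuous_on_subset) (use x in auto)
  define I where "I = integral {x..l} f"
  define J where "J = integral {x..l} (\<lambda>y. (f y)\<^sup>2)"
  have i1: "f integrable_on {x..l}" "(\<lambda>y. (f y)\<^sup>2) integrable_on {x..l}"
    by (auto intro!: integrable_continuous_interval continuous_intros fx)
  \<comment> \<open>The integrand is \<open>(f y - I / l)\<^sup>2\<close>. Centering at
    \<open>I / l\<close> instead of the mean over \<open>{x..l}\<close> yields the factor
    \<open>l\<close> for all \<open>x\<close> at once and avoids a division by zero at
    \<open>x = l\<close>.\<close>
  have hi: "((\<lambda>y. (f y)\<^sup>2 - 2 * (I / l) * f y + (I / l)\<^sup>2) has_integral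
      (J - 2 * (I / l) * I + (l - x) * (I / l)\<^sup>2)) {x..l}"
    unfolding I_def J_def
    using has_integral_const_real[of "(integral {x..l} f / l)\<^sup>2" x l] x
    by (intro has_integral_add has_integral_diff has_integral_mult_right integrable_integral i1) auto
  have "0 \<le> J - 2 * (I / l) * I + (l - x) * (I / l)\<^sup>2"
  proof (rule has_integral_nonneg[OF hi])
    fix y
    have "(f y)\<^sup>2 - 2 * (I / l) * f y + (I / l)\<^sup>2 = (f y - I / l)\<^sup>2"
      by (simp add: power2_diff)
    then show "0 \<le> (f y)\<^sup>2 - 2 * (I / l) * f y + (I / l)\<^sup>2" by simp
  qed
  moreover have "(l - x) * (I / l)\<^sup>2 \<le> l * (I / l)\<^sup>2" using x by (intro mult_right_mono) auto
  moreover have "l * (I / l)\<^sup>2 = I\<^sup>2 / l" "2 * (I / l) * I = 2 * (I\<^sup>2 / l)"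
    using l by (simp_all add: power2_eq_square field_simps)
  ultimately have "I\<^sup>2 / l \<le> J" by linarith
  then have "I\<^sup>2 \<le> l * J" using l by (simp add: field_simps)
  also have "J \<le> integral {0..l} (\<lambda>y. (f y)\<^sup>2)"
    unfolding J_def using x
    by (intro integral_subset_le i1 integrable_continuous_interval continuous_intros f) auto
  finally show ?thesis unfolding I_def using l by simp
qed

section \<open>Pointwise dissipation estimate\<close>

lemma abs_mult_le_squares: "\<bar>x\<bar> * \<bar>y\<bar> \<le> (x\<^sup>2 + y\<^sup>2) / 2" for x y :: real
proof -
  have "0 \<le> (\<bar>x\<bar> - \<bar>y\<bar>)\<^sup>2" by simp
  then show ?thesis by (simp add: power2_diff)
qed

text \<open>\<open>Dmin\<close> and \<open>Dmax\<close> make the potential part of the relative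
  energy comparable to the squared density difference; \<open>Dmin\<close> also drives the density
  damping. The third derivative enters because the rate of the relative energy contains the
  first-order Taylor remainder of \<open>P1\<close>, which must be quadratic.\<close>

locale pressure_bounds =
  fixes P P1 P2 P3 :: "real \<Rightarrow> real" and \<rho>min \<rho>max Dmin Dmax K3 :: real
  assumes \<rho>min: "0 < \<rho>min"
    and P1: "\<And>r. 0 < r \<Longrightarrow> (P has_real_derivative P1 r) (at r)"
    and P2: "\<And>r. 0 < r \<Longrightarrow> (P1 has_real_derivative P2 r) (at r)"
    and P3: "\<And>r. 0 < r \<Longrightarrow> (P2 has_real_derivative P3 r) (at r)"
    and Dmin: "0 < Dmin" "\<And>r. r \<in> {\<rho>min..\<rho>max} \<Longrightarrow> Dmin \<le> P2 r"
    and Dmax: "\<And>r. r \<in> {\<rho>min..\<rho>max} \<Longrightarrow> P2 r \<le> Dmax"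
    and K3: "\<And>r. r \<in> {\<rho>min..\<rho>max} \<Longrightarrow> \<bar>P3 r\<bar> \<le> K3"
begin

text \<open>Stated for a general \<open>f\<close> because it is applied to \<open>P\<close>, for the
  size of the relative energy, and to \<open>P1\<close>, for the remainder in its rate.\<close>

lemma second_order_taylor:
  assumes f: "\<And>x. 0 < x \<Longrightarrow> (f has_real_derivative f' x) (at x)"
    and f': "\<And>x. 0 < x \<Longrightarrow> (f' has_real_derivative f'' x) (at x)"
    and rs: "r \<in> {\<rho>min..\<rho>max}" "s \<in> {\<rho>min..\<rho>max}"
  shows "\<exists>\<xi>\<in>{\<rho>min..\<rho>max}. f s - f r - f' r * (s - r) = f'' \<xi> / 2 * (s - r)\<^sup>2"
proof (cases "s = r")
  case True
  then show ?thesis using rs by auto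
next
  case False
  define d where "d n = (if n = 0 then f else if n = 1 then f' else f'')" for n :: nat
  have "\<exists>t. (if s < r then s < t \<and> t < r else r < t \<and> t < s) \<and>
      f s = (\<Sum>m<2. (d m r / fact m) * (s - r) ^ m) + (d 2 t / fact 2) * (s - r) ^ 2"
    by (rule Taylor[of 2 d f \<rho>min \<rho>max r s])
      (use rs False \<rho>min f f' in \<open>auto simp: d_def less_2_cases_iff\<close>)
  then obtain t where "if s < r then s < t \<and> t < r else r < t \<and> t < s"
    "f s = (\<Sum>m<2. (d m r / fact m) * (s - r) ^ m) + (d 2 t / fact 2) * (s - r) ^ 2" by blast
  then show ?thesis using rs
    by (intro bexI[of _ t]) (auto simp: d_def numeral_2_eq_2 split: if_splits)
qed

lemma P1_monotone:
  assumes rs: "r \<in> {\<rho>min..\<rho>max}" "s \<in> {\<rho>min..\<rho>max}"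
  shows "Dmin * (s - r)\<^sup>2 \<le> (P1 s - P1 r) * (s - r)"
proof -
  have *: "Dmin * (v - u)\<^sup>2 \<le> (P1 v - P1 u) * (v - u)"
    if "u < v" "u \<in> {\<rho>min..\<rho>max}" "v \<in> {\<rho>min..\<rho>max}" for u v
  proof -
    obtain z where z: "u < z" "z < v" "P1 v - P1 u = (v - u) * P2 z"
    proof -
      have "(P1 has_real_derivative P2 x) (at x)" if "u \<le> x" for x
        using P2 \<rho>min that \<open>u \<in> _\<close> by auto
      then show thesis using MVT2[OF \<open>u < v\<close>, of P1 P2] that by blast
    qed
    then have "Dmin \<le> P2 z" using that by (intro Dmin) auto
    then have "Dmin * ((v - u) * (v - u)) \<le> P2 z * ((v - u) * (v - u))"
      by (intro mult_right_mono) auto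
    then show ?thesis unfolding z(3) by (simp add: power2_eq_square algebra_simps)
  qed
  consider "r < s" | "s < r" | "r = s" by linarith
  then show ?thesis
  proof cases
    case 2
    then show ?thesis using *[of s r] rs by (simp add: power2_eq_square algebra_simps)
  qed (use * rs in auto)
qed

lemma P_remainder_bounds:
  assumes "r \<in> {\<rho>min..\<rho>max}" "s \<in> {\<rho>min..\<rho>max}"
  shows "Dmin / 2 * (s - r)\<^sup>2 \<le> P s - P r - P1 r * (s - r)"
    and "P s - P r - P1 r * (s - r) \<le> Dmax / 2 * (s - r)\<^sup>2"
proof -
  obtain \<xi> where \<xi>: "\<xi> \<in> {\<rho>min..\<rho>max}" "P s - P r - P1 r * (s - r) = P2 \<xi> / 2 * (s - r)\<^sup>2"
    using second_order_taylor[of P P1 P2, OF P1 P2 assms] by blast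
  show "Dmin / 2 * (s - r)\<^sup>2 \<le> P s - P r - P1 r * (s - r)"
    unfolding \<xi>(2) using Dmin(2)[OF \<xi>(1)] by (intro mult_right_mono) auto
  show "P s - P r - P1 r * (s - r) \<le> Dmax / 2 * (s - r)\<^sup>2"
    unfolding \<xi>(2) using Dmax[OF \<xi>(1)] by (intro mult_right_mono) auto
qed

lemma P1_remainder_bound:
  assumes "r \<in> {\<rho>min..\<rho>max}" "s \<in> {\<rho>min..\<rho>max}"
  shows "\<bar>P1 s - P1 r - P2 r * (s - r)\<bar> \<le> K3 / 2 * (s - r)\<^sup>2"
proof -
  obtain \<xi> where \<xi>: "\<xi> \<in> {\<rho>min..\<rho>max}" "P1 s - P1 r - P2 r * (s - r) = P3 \<xi> / 2 * (s - r)\<^sup>2"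
    using second_order_taylor[of P1 P2 P3, OF P2 P3 assms] by blast
  show ?thesis
    unfolding \<xi>(2) abs_mult using K3[OF \<xi>(1)] by (intro mult_mono) auto
qed

lemma Lip_P1: "Lip {\<rho>min..\<rho>max} P1"
proof (rule C1_imp_Lip)
  show "(P1 has_real_derivative P2 r) (at r)" if "r \<in> {\<rho>min..\<rho>max}" for r
    using that \<rho>min by (intro P2) auto
  show "continuous_on {\<rho>min..\<rho>max} P2"
    using \<rho>min by (intro continuous_at_imp_continuous_on ballI DERIV_isCont[OF P3]) auto
qed

lemma Lip_P: "Lip {\<rho>min..\<rho>max} P"
proof (rule C1_imp_Lip)
  show "(P has_real_derivative P1 r) (at r)" if "r \<in> {\<rho>min..\<rho>max}" for r
    using that \<rho>min by (intro P1) auto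
qed (rule Lip_continuous[OF Lip_P1])

text \<open>The Bregman distance of the energy density \<open>\<rho> v\<^sup>2 / 2 + P \<rho>\<close>, expanded at the
  original state \<open>(\<rho>, v)\<close> and evaluated at the observer state \<open>(\<rho>h, vh)\<close>.\<close>

definition rel_energy :: "real \<Rightarrow> real \<Rightarrow> real \<Rightarrow> real \<Rightarrow> real" where
  "rel_energy \<rho> v \<rho>h vh = \<rho>h / 2 * (vh - v)\<^sup>2 + (\<rho>h - \<rho>) * v * (vh - v) +
    (P \<rho>h - P \<rho> - P1 \<rho> * (\<rho>h - \<rho>))"

text \<open>Only the mixed term has no sign. It carries the factor \<open>v\<close>, so a small
  velocity lets Young's inequality hide it in the two squares; this is one source of the smallness
  condition on the velocity.\<close>

lemma rel_energy_bounds: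
  assumes \<rho>: "\<rho> \<in> {\<rho>min..\<rho>max}" and \<rho>h: "\<rho>h \<in> {\<rho>min..\<rho>max}"
    and v: "\<bar>v\<bar> \<le> \<eta>"
  shows "(min \<rho>min Dmin - \<eta>) / 2 * ((\<rho> - \<rho>h)\<^sup>2 + (v - vh)\<^sup>2) \<le> rel_energy \<rho> v \<rho>h vh"
    and "rel_energy \<rho> v \<rho>h vh \<le> (max \<rho>max Dmax + \<eta>) / 2 * ((\<rho> - \<rho>h)\<^sup>2 + (v - vh)\<^sup>2)"
proof -
  define r d where "r = \<rho>h - \<rho>" and "d = vh - v"
  have sq: "(\<rho> - \<rho>h)\<^sup>2 = r\<^sup>2" "(v - vh)\<^sup>2 = d\<^sup>2" by (auto simp: r_def d_def power2_commute)
  have E: "rel_energy \<rho> v \<rho>h vh = \<rho>h / 2 * d\<^sup>2 + r * v * d + (P \<rho>h - P \<rho> - P1 \<rho> * r)"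
    by (simp add: rel_energy_def r_def d_def)
  have "\<bar>r * v * d\<bar> = \<bar>v\<bar> * (\<bar>r\<bar> * \<bar>d\<bar>)" by (simp add: abs_mult)
  also have "\<dots> \<le> \<eta> * ((r\<^sup>2 + d\<^sup>2) / 2)"
    using v by (intro mult_mono abs_mult_le_squares) auto
  finally have c: "\<bar>r * v * d\<bar> \<le> (\<eta> * r\<^sup>2 + \<eta> * d\<^sup>2) / 2" by (simp add: distrib_left)
  note b = P_remainder_bounds[OF \<rho> \<rho>h, folded r_def]
  define l where "l = min \<rho>min Dmin"
  have "l * d\<^sup>2 \<le> \<rho>h * d\<^sup>2" "l * r\<^sup>2 \<le> Dmin * r\<^sup>2"
    using \<rho>h by (auto intro!: mult_right_mono simp: l_def)
  then have "(l - \<eta>) / 2 * (r\<^sup>2 + d\<^sup>2) \<le> \<rho>h / 2 * d\<^sup>2 + r * v * d + (P \<rho>h - P \<rho> - P1 \<rho> * r)"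
    using b(1) c by (simp add: abs_le_iff field_simps)
  then show "(min \<rho>min Dmin - \<eta>) / 2 * ((\<rho> - \<rho>h)\<^sup>2 + (v - vh)\<^sup>2) \<le> rel_energy \<rho> v \<rho>h vh"
    unfolding sq E l_def .
  define g where "g = max \<rho>max Dmax"
  have "\<rho>h * d\<^sup>2 \<le> g * d\<^sup>2" "Dmax * r\<^sup>2 \<le> g * r\<^sup>2"
    using \<rho>h by (auto intro!: mult_right_mono simp: g_def)
  then have "\<rho>h / 2 * d\<^sup>2 + r * v * d + (P \<rho>h - P \<rho> - P1 \<rho> * r) \<le> (g + \<eta>) / 2 * (r\<^sup>2 + d\<^sup>2)"
    using b(2) c by (simp add: abs_le_iff field_simps)
  then show "rel_energy \<rho> v \<rho>h vh \<le> (max \<rho>max Dmax + \<eta>) / 2 * ((\<rho> - \<rho>h)\<^sup>2 + (v - vh)\<^sup>2)"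
    unfolding sq E g_def .
qed

end

text \<open>Monotonicity of \<open>\<bar>v\<bar> * v\<close> gives the leading friction term the
  good sign. The second bound makes what is left of friction small with the velocities.\<close>

lemma friction_monotone:
  fixes v w :: real
  shows "0 \<le> (\<bar>v\<bar> * v - \<bar>w\<bar> * w) * (v - w)"
  and "\<bar>v\<bar> \<le> \<eta> \<Longrightarrow> \<bar>w\<bar> \<le> \<eta> \<Longrightarrow> \<bar>\<bar>v\<bar> * v - \<bar>w\<bar> * w\<bar> \<le> 2 * \<eta> * \<bar>v - w\<bar>"
proof -
  have *: "0 \<le> (\<bar>v\<bar> * v - \<bar>w\<bar> * w) * (v - w)" if "v \<le> w" for v w :: real
  proof -
    have "\<bar>v\<bar> * v \<le> \<bar>w\<bar> * w"
    proof (cases "0 \<le> v")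
      case True then show ?thesis using that by (auto intro!: mult_mono)
    next
      case False
      show ?thesis
      proof (cases "0 \<le> w")
        case True
        have "\<bar>v\<bar> * v \<le> 0" using False by (auto simp: mult_le_0_iff)
        also have "0 \<le> \<bar>w\<bar> * w" using True by simp
        finally show ?thesis .
      next
        case f: False
        have "(- w) * (- w) \<le> (- v) * (- v)" using f that by (intro mult_mono) auto
        then show ?thesis using f False by simp
      qed
    qed
    then show ?thesis using that by (auto simp: zero_le_mult_iff)
  qed
  show "0 \<le> (\<bar>v\<bar> * v - \<bar>w\<bar> * w) * (v - w)"
    using *[of v w] *[of w v] by (cases "v \<le> w") (auto simp: algebra_simps)
  assume "\<bar>v\<bar> \<le> \<eta>" "\<bar>w\<bar> \<le> \<eta>"
  have "\<bar>v\<bar> * v - \<bar>w\<bar> * w = \<bar>v\<bar> * (v - w) + (\<bar>v\<bar> - \<bar>w\<bar>) * w" by (simp add: algebra_simps)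
  also have "\<bar>\<dots>\<bar> \<le> \<bar>v\<bar> * \<bar>v - w\<bar> + \<bar>\<bar>v\<bar> - \<bar>w\<bar>\<bar> * \<bar>w\<bar>"
    using abs_triangle_ineq[of "\<bar>v\<bar> * (v - w)" "(\<bar>v\<bar> - \<bar>w\<bar>) * w"] by (simp add: abs_mult)
  also have "\<dots> \<le> \<eta> * \<bar>v - w\<bar> + \<bar>v - w\<bar> * \<eta>"
    using \<open>\<bar>v\<bar> \<le> \<eta>\<close> \<open>\<bar>w\<bar> \<le> \<eta>\<close> by (intro add_mono mult_mono) auto
  finally show "\<bar>\<bar>v\<bar> * v - \<bar>w\<bar> * w\<bar> \<le> 2 * \<eta> * \<bar>v - w\<bar>" by simp
qed

text \<open>\<open>\<epsilon>\<close> weighs the correction of the relative energy, \<open>\<eta>\<close> bounds both \<open>C\<^sub>t\<close> and the velocities,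
  and \<open>c0\<close> is the damping rate of the velocity difference that works for either measurement.\<close>

locale observer_bounds = pressure_bounds +
  fixes \<gamma> \<mu> L \<epsilon> \<eta> c0 :: real
  assumes \<gamma>: "0 \<le> \<gamma>" and \<mu>: "0 < \<mu>" and L: "1 \<le> L" and \<rho>max: "0 < \<rho>max"
    and c0_def: "c0 = \<mu> * min \<rho>min (\<rho>min\<^sup>2 / 2)"
    and \<epsilon>: "0 < \<epsilon>" "\<epsilon> \<le> 1"
      "\<epsilon> * ((2 * \<gamma> + \<mu> * (1 + \<rho>max))\<^sup>2 * L\<^sup>2 / Dmin + \<rho>max) \<le> c0 / 2"
      "\<epsilon> * (1 + L\<^sup>2) \<le> min \<rho>min Dmin / 4"
    and \<eta>: "0 < \<eta>" "\<eta> \<le> 1" "\<eta> \<le> min \<rho>min Dmin / 2"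
      "(\<gamma> + \<mu> + (1 + K3) + 2 + \<mu> + \<mu> * L\<^sup>2) * \<eta> \<le> min c0 (\<epsilon> * Dmin) / 4"
begin

text \<open>The left-hand side is what remains of the energy balance once the equations are
  inserted. The source \<open>s\<close> damps \<open>b\<close>, the term
  \<open>- \<epsilon> * h * a\<close> damps \<open>a\<close>, and everything else is a perturbation.
  The square of \<open>R\<close> has to stay on the right, as \<open>R\<close> is not controlled
  pointwise by \<open>a\<close>; its factor is such that after integration it uses up half of the
  damping of \<open>a\<close>.\<close>

lemma dissipation_pointwise:
  fixes \<rho> v \<rho>h vh \<rho>t vt R \<sigma> :: real
  defines "a \<equiv> \<rho> - \<rho>h" and "b \<equiv> v - vh" and "m \<equiv> \<rho> * v - \<rho>h * vh"
    and "h \<equiv> 1 / 2 * v\<^sup>2 + P1 \<rho> - (1 / 2 * vh\<^sup>2 + P1 \<rho>h)"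
  defines "s \<equiv> - \<gamma> * (\<bar>v\<bar> * v - \<bar>vh\<bar> * vh) - \<mu> * \<sigma>"
  assumes \<rho>: "\<rho> \<in> {\<rho>min..\<rho>max}" and \<rho>h: "\<rho>h \<in> {\<rho>min..\<rho>max}"
    and v: "\<bar>v\<bar> \<le> \<eta>" and vh: "\<bar>vh\<bar> \<le> \<eta>"
    and \<rho>t: "\<bar>\<rho>t\<bar> \<le> \<eta>" and vt: "\<bar>vt\<bar> \<le> \<eta>" and \<sigma>: "\<sigma> = b \<or> \<sigma> = m"
  shows "s * m + (\<rho>t * (1 / 2 * b\<^sup>2 + (P1 \<rho>h - P1 \<rho> - P2 \<rho> * (\<rho>h - \<rho>))) + vt * a * b)
      - \<epsilon> * h * a - \<epsilon> * s * R + \<epsilon> * b * m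
    \<le> 3 / 8 * (\<epsilon> * Dmin / L\<^sup>2) * R\<^sup>2 - 3 / 4 * (\<epsilon> * Dmin) * a\<^sup>2 - c0 / 4 * b\<^sup>2"
proof -
  define F where "F = \<bar>v\<bar> * v - \<bar>vh\<bar> * vh"
  define S where "S = 2 * \<gamma> + \<mu> * (1 + \<rho>max)"
  have \<rho>pos: "0 < \<rho>" using \<rho> \<rho>min by auto
  \<comment> \<open>This splitting decides every estimate below: the part of \<open>m\<close> that
    involves \<open>a\<close> carries the small factor \<open>vh\<close>.\<close>
  have m: "m = \<rho> * b + vh * a" by (simp add: m_def a_def b_def algebra_simps)
  have Fb: "0 \<le> F * b" unfolding F_def b_def by (rule friction_monotone)
  have F: "\<bar>F\<bar> \<le> 2 * \<eta> * \<bar>b\<bar>" unfolding F_def b_def by (rule friction_monotone(2)[OF v vh])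
  have ab: "\<bar>a\<bar> * \<bar>b\<bar> \<le> (a\<^sup>2 + b\<^sup>2) / 2" by (rule abs_mult_le_squares)
  have \<eta>ab: "\<bar>x\<bar> * (\<bar>a\<bar> * \<bar>b\<bar>) \<le> \<eta> * ((a\<^sup>2 + b\<^sup>2) / 2)" if "\<bar>x\<bar> \<le> \<eta>" for x
    using that ab \<eta>(1) by (intro mult_mono) auto
  have vhab: "\<bar>vh * a * b\<bar> \<le> \<eta> * ((a\<^sup>2 + b\<^sup>2) / 2)"
    using \<eta>ab[OF vh] by (simp add: abs_mult mult.assoc)
  have S1: "s * m \<le> - c0 * b\<^sup>2 + (\<gamma> + \<mu>) * (\<eta> * (a\<^sup>2 + b\<^sup>2))"
  proof -
    have "\<bar>F * vh * a\<bar> \<le> (2 * \<eta> * \<bar>b\<bar>) * 1 * \<bar>a\<bar>"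
      unfolding abs_mult using F vh \<eta>(2) by (intro mult_mono) auto
    also have "\<dots> \<le> \<eta> * (a\<^sup>2 + b\<^sup>2)"
      using mult_left_mono[OF ab, of "2 * \<eta>"] \<eta>(1) by (simp add: algebra_simps)
    finally have "- (F * vh * a) \<le> \<eta> * (a\<^sup>2 + b\<^sup>2)" by linarith
    moreover have "0 \<le> \<rho> * (F * b)" using Fb \<rho>pos by simp
    \<comment> \<open>The first summand is nonnegative by monotonicity of friction, so only the
      second one has to be estimated.\<close>
    moreover have "F * m = \<rho> * (F * b) + F * vh * a" unfolding m by (simp add: algebra_simps)
    ultimately have "- (F * m) \<le> \<eta> * (a\<^sup>2 + b\<^sup>2)" by linarith
    then have 1: "\<gamma> * - (F * m) \<le> \<gamma> * (\<eta> * (a\<^sup>2 + b\<^sup>2))" using \<gamma> by (rule mult_left_mono)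
    have "- (\<sigma> * m) \<le> - min \<rho>min (\<rho>min\<^sup>2 / 2) * b\<^sup>2 + \<eta> * (a\<^sup>2 + b\<^sup>2)"
      using \<sigma>
    proof
      assume "\<sigma> = b"
      have "\<sigma> * m = \<rho> * b\<^sup>2 + vh * a * b" unfolding m \<open>\<sigma> = b\<close> by (simp add: power2_eq_square algebra_simps)
      moreover have "min \<rho>min (\<rho>min\<^sup>2 / 2) * b\<^sup>2 \<le> \<rho> * b\<^sup>2" using \<rho> by (intro mult_right_mono) auto
      moreover have "0 \<le> \<eta> * ((a\<^sup>2 + b\<^sup>2) / 2)" using \<eta>(1) by simp
      ultimately show ?thesis using vhab by (simp add: abs_le_iff)
    next
      assume "\<sigma> = m"
      \<comment> \<open>Half of the square of the main part of \<open>m\<close> survives when the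
        part with \<open>vh\<close> is split off. This is the origin of
        \<open>\<rho>min\<^sup>2 / 2\<close> in \<open>c0\<close>; the alternative
        \<open>\<rho>min\<close> belongs to velocity measurements.\<close>
      have "(\<rho> * b)\<^sup>2 / 2 - (vh * a)\<^sup>2 \<le> \<sigma> * m"
      proof -
        have "\<sigma> * m - ((\<rho> * b)\<^sup>2 / 2 - (vh * a)\<^sup>2) = (\<rho> * b + 2 * (vh * a))\<^sup>2 / 2"
          unfolding \<open>\<sigma> = m\<close> m by (simp add: power2_eq_square field_simps)
        then show ?thesis using zero_le_power2[of "\<rho> * b + 2 * (vh * a)"] by linarith
      qed
      moreover have "min \<rho>min (\<rho>min\<^sup>2 / 2) \<le> \<rho>\<^sup>2 / 2"
        using \<rho> \<rho>min power_mono[of \<rho>min \<rho> 2] by (intro min.coboundedI2) auto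
      then have "min \<rho>min (\<rho>min\<^sup>2 / 2) * b\<^sup>2 \<le> (\<rho>\<^sup>2 / 2) * b\<^sup>2" by (rule mult_right_mono) simp
      moreover have "vh\<^sup>2 \<le> \<eta>"
      proof -
        have "\<bar>vh\<bar> * \<bar>vh\<bar> \<le> \<eta> * 1" using vh \<eta> by (intro mult_mono) auto
        then show ?thesis by (simp add: power2_eq_square flip: abs_mult)
      qed
      then have "vh\<^sup>2 * a\<^sup>2 \<le> \<eta> * a\<^sup>2" by (intro mult_right_mono) auto
      moreover have "0 \<le> \<eta> * b\<^sup>2" using \<eta>(1) by simp
      ultimately show ?thesis by (simp add: power_mult_distrib distrib_left)
    qed
    then have "\<mu> * - (\<sigma> * m) \<le> \<mu> * (- min \<rho>min (\<rho>min\<^sup>2 / 2) * b\<^sup>2 + \<eta> * (a\<^sup>2 + b\<^sup>2))"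
      using \<mu> by (intro mult_left_mono) auto
    then have 2: "\<mu> * - (\<sigma> * m) \<le> - c0 * b\<^sup>2 + \<mu> * (\<eta> * (a\<^sup>2 + b\<^sup>2))"
      unfolding c0_def by (simp add: algebra_simps)
    have "s * m = \<gamma> * - (F * m) + \<mu> * - (\<sigma> * m)" unfolding s_def F_def by (simp add: algebra_simps)
    also have "\<dots> \<le> - c0 * b\<^sup>2 + (\<gamma> + \<mu>) * (\<eta> * (a\<^sup>2 + b\<^sup>2))"
      using 1 2 by (simp add: distrib_right)
    finally show ?thesis .
  qed
  have K3nn: "0 \<le> K3" using K3[OF \<rho>] by linarith
  have S2: "\<rho>t * (1 / 2 * b\<^sup>2 + (P1 \<rho>h - P1 \<rho> - P2 \<rho> * (\<rho>h - \<rho>))) + vt * a * b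
      \<le> (1 + K3) * (\<eta> * (a\<^sup>2 + b\<^sup>2))"
  proof -
    have r: "\<bar>P1 \<rho>h - P1 \<rho> - P2 \<rho> * (\<rho>h - \<rho>)\<bar> \<le> K3 / 2 * a\<^sup>2"
      using P1_remainder_bound[OF \<rho> \<rho>h] by (simp add: a_def power2_commute)
    have "\<rho>t * (1 / 2 * b\<^sup>2 + (P1 \<rho>h - P1 \<rho> - P2 \<rho> * (\<rho>h - \<rho>)))
        \<le> \<bar>\<rho>t\<bar> * \<bar>1 / 2 * b\<^sup>2 + (P1 \<rho>h - P1 \<rho> - P2 \<rho> * (\<rho>h - \<rho>))\<bar>"
      by (metis abs_ge_self abs_mult)
    also have "\<dots> \<le> \<eta> * (1 / 2 * b\<^sup>2 + K3 / 2 * a\<^sup>2)"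
    proof (rule mult_mono[OF \<rho>t])
      show "\<bar>1 / 2 * b\<^sup>2 + (P1 \<rho>h - P1 \<rho> - P2 \<rho> * (\<rho>h - \<rho>))\<bar> \<le> 1 / 2 * b\<^sup>2 + K3 / 2 * a\<^sup>2"
        by (rule order_trans[OF abs_triangle_ineq]) (use r in simp)
    qed (use \<eta>(1) in auto)
    finally have 1: "\<rho>t * (1 / 2 * b\<^sup>2 + (P1 \<rho>h - P1 \<rho> - P2 \<rho> * (\<rho>h - \<rho>)))
        \<le> \<eta> * (1 / 2 * b\<^sup>2 + K3 / 2 * a\<^sup>2)" .
    have "vt * a * b \<le> \<bar>vt\<bar> * (\<bar>a\<bar> * \<bar>b\<bar>)" by (metis abs_ge_self abs_mult mult.assoc)
    also have "\<dots> \<le> \<eta> * ((a\<^sup>2 + b\<^sup>2) / 2)" by (rule \<eta>ab[OF vt])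
    finally have 2: "vt * a * b \<le> \<eta> * ((a\<^sup>2 + b\<^sup>2) / 2)" .
    have "(1 + K3) * (\<eta> * (a\<^sup>2 + b\<^sup>2)) - (\<eta> * (1 / 2 * b\<^sup>2 + K3 / 2 * a\<^sup>2) + \<eta> * ((a\<^sup>2 + b\<^sup>2) / 2))
        = \<eta> * ((1 + K3) / 2 * a\<^sup>2 + K3 * b\<^sup>2)" by (simp add: field_simps)
    moreover have "0 \<le> \<eta> * ((1 + K3) / 2 * a\<^sup>2 + K3 * b\<^sup>2)"
      using \<eta>(1) K3nn by (intro mult_nonneg_nonneg add_nonneg_nonneg) auto
    ultimately show ?thesis using 1 2 by linarith
  qed
  \<comment> \<open>The damping of the density difference arises here, from strong monotonicity of
    \<open>P1\<close>; the kinetic part of the enthalpy is a small mixed term.\<close>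
  have S3: "- (h * a) \<le> - Dmin * a\<^sup>2 + \<eta> * (a\<^sup>2 + b\<^sup>2)"
  proof -
    have "h * a = (P1 \<rho> - P1 \<rho>h) * (\<rho> - \<rho>h) + (v + vh) / 2 * a * b"
      unfolding h_def a_def b_def by (simp add: power2_eq_square field_simps)
    moreover have "Dmin * a\<^sup>2 \<le> (P1 \<rho> - P1 \<rho>h) * (\<rho> - \<rho>h)"
      unfolding a_def by (rule P1_monotone[OF \<rho>h \<rho>])
    moreover have "\<bar>(v + vh) / 2\<bar> \<le> \<eta>"
      using abs_triangle_ineq[of v vh] v vh by simp
    from \<eta>ab[OF this] have "\<bar>(v + vh) / 2 * a * b\<bar> \<le> \<eta> * ((a\<^sup>2 + b\<^sup>2) / 2)"
      by (simp add: abs_mult mult.assoc)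
    moreover have "0 \<le> \<eta> * ((a\<^sup>2 + b\<^sup>2) / 2)" using \<eta>(1) by simp
    ultimately show ?thesis by (simp add: abs_le_iff)
  qed
  have S4: "- (s * R) \<le> (S\<^sup>2 * L\<^sup>2 / Dmin) * b\<^sup>2 + Dmin / (4 * L\<^sup>2) * R\<^sup>2 + \<mu> * (\<eta> * ((a\<^sup>2 + R\<^sup>2) / 2))"
  proof -
    have m': "\<bar>m\<bar> \<le> \<rho>max * \<bar>b\<bar> + \<eta> * \<bar>a\<bar>"
    proof -
      have "\<bar>m\<bar> \<le> \<bar>\<rho>\<bar> * \<bar>b\<bar> + \<bar>vh\<bar> * \<bar>a\<bar>" unfolding m by (metis abs_mult abs_triangle_ineq)
      also have "\<dots> \<le> \<rho>max * \<bar>b\<bar> + \<eta> * \<bar>a\<bar>"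
        using \<rho> \<rho>pos vh by (intro add_mono mult_right_mono) auto
      finally show ?thesis .
    qed
    have "0 \<le> \<rho>max * \<bar>b\<bar>" "0 \<le> \<eta> * \<bar>a\<bar>" using \<rho>max \<eta>(1) by auto
    then have "\<bar>\<sigma>\<bar> \<le> (1 + \<rho>max) * \<bar>b\<bar> + \<eta> * \<bar>a\<bar>"
      using \<sigma> m' abs_ge_zero[of b] by (auto simp only: distrib_right mult_1)
    then have "\<mu> * \<bar>\<sigma>\<bar> \<le> \<mu> * ((1 + \<rho>max) * \<bar>b\<bar> + \<eta> * \<bar>a\<bar>)" using \<mu> by (intro mult_left_mono) auto
    moreover have "\<gamma> * \<bar>F\<bar> \<le> \<gamma> * (2 * 1 * \<bar>b\<bar>)"
      using F \<eta> \<gamma> by (intro mult_left_mono order_trans[OF F] mult_right_mono) auto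
    moreover have "\<bar>s\<bar> \<le> \<gamma> * \<bar>F\<bar> + \<mu> * \<bar>\<sigma>\<bar>"
    proof -
      have "\<bar>s\<bar> \<le> \<bar>\<gamma> * F\<bar> + \<bar>\<mu> * \<sigma>\<bar>" unfolding s_def F_def[symmetric] by linarith
      then show ?thesis using \<gamma> \<mu> by (simp add: abs_mult)
    qed
    ultimately have s: "\<bar>s\<bar> \<le> S * \<bar>b\<bar> + \<mu> * \<eta> * \<bar>a\<bar>"
      unfolding S_def by (simp add: algebra_simps)
    \<comment> \<open>The weight is chosen so that \<open>R\<^sup>2\<close> gets the factor
      \<open>Dmin / (4 * L\<^sup>2)\<close>. The price is a large factor at
      \<open>b\<^sup>2\<close>, which the smallness of \<open>\<epsilon>\<close> has to pay
      for.\<close>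
    have young: "S * \<bar>b\<bar> * \<bar>R\<bar> \<le> (S\<^sup>2 * L\<^sup>2 / Dmin) * b\<^sup>2 + Dmin / (4 * L\<^sup>2) * R\<^sup>2"
    proof -
      have pos: "0 < Dmin" "0 < L" using Dmin L by auto
      have "(S\<^sup>2 * L\<^sup>2 / Dmin) * b\<^sup>2 + Dmin / (4 * L\<^sup>2) * R\<^sup>2 - S * \<bar>b\<bar> * \<bar>R\<bar> =
          (2 * L\<^sup>2 * S * \<bar>b\<bar> - Dmin * \<bar>R\<bar>)\<^sup>2 / (4 * L\<^sup>2 * Dmin)"
        using pos by (simp add: power2_diff power_mult_distrib field_simps power2_eq_square)
      moreover have "0 \<le> \<dots>" using pos by simp
      ultimately show ?thesis by linarith
    qed
    have "- (s * R) \<le> \<bar>s\<bar> * \<bar>R\<bar>" by (metis abs_ge_minus_self abs_mult)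
    also have "\<dots> \<le> (S * \<bar>b\<bar> + \<mu> * \<eta> * \<bar>a\<bar>) * \<bar>R\<bar>" using s by (intro mult_right_mono) auto
    also have "\<dots> = S * \<bar>b\<bar> * \<bar>R\<bar> + \<mu> * (\<eta> * (\<bar>a\<bar> * \<bar>R\<bar>))" by (simp add: algebra_simps)
    also have "\<dots> \<le> (S\<^sup>2 * L\<^sup>2 / Dmin) * b\<^sup>2 + Dmin / (4 * L\<^sup>2) * R\<^sup>2 + \<mu> * (\<eta> * ((a\<^sup>2 + R\<^sup>2) / 2))"
      using \<mu> \<eta>(1) by (intro add_mono young mult_left_mono abs_mult_le_squares) auto
    finally show ?thesis .
  qed
  have S5: "b * m \<le> \<rho>max * b\<^sup>2 + \<eta> * (a\<^sup>2 + b\<^sup>2)"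
  proof -
    have "b * m = \<rho> * b\<^sup>2 + vh * a * b" unfolding m by (simp add: power2_eq_square algebra_simps)
    moreover have "\<rho> * b\<^sup>2 \<le> \<rho>max * b\<^sup>2" using \<rho> by (intro mult_right_mono) auto
    moreover have "0 \<le> \<eta> * ((a\<^sup>2 + b\<^sup>2) / 2)" using \<eta>(1) by simp
    ultimately show ?thesis using vhab by (simp add: abs_le_iff)
  qed
  define k where "k = (\<gamma> + \<mu> + (1 + K3) + 2) * \<eta>"
  have "\<epsilon> * (- (h * a) + - (s * R) + b * m) \<le> \<epsilon> * (- Dmin * a\<^sup>2 + \<eta> * (a\<^sup>2 + b\<^sup>2) +
      ((S\<^sup>2 * L\<^sup>2 / Dmin) * b\<^sup>2 + Dmin / (4 * L\<^sup>2) * R\<^sup>2 + \<mu> * (\<eta> * ((a\<^sup>2 + R\<^sup>2) / 2))) +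
      (\<rho>max * b\<^sup>2 + \<eta> * (a\<^sup>2 + b\<^sup>2)))"
    using \<epsilon>(1) by (intro mult_left_mono add_mono S3 S4 S5) auto
  also have "\<dots> = - (\<epsilon> * Dmin) * a\<^sup>2 + (\<epsilon> * (S\<^sup>2 * L\<^sup>2 / Dmin + \<rho>max)) * b\<^sup>2
      + (\<epsilon> * Dmin / L\<^sup>2) / 4 * R\<^sup>2 + \<epsilon> * (2 * \<eta> * (a\<^sup>2 + b\<^sup>2) + \<mu> * (\<eta> * ((a\<^sup>2 + R\<^sup>2) / 2)))"
    by (simp add: algebra_simps)
  \<comment> \<open>The third condition on \<open>\<epsilon>\<close> limits the loss in
    \<open>b\<^sup>2\<close> to \<open>c0 / 2\<close>; in the terms that are already small with
    \<open>\<eta>\<close>, \<open>\<epsilon>\<close> is simply replaced by one.\<close>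
  also have "\<dots> \<le> - (\<epsilon> * Dmin) * a\<^sup>2 + c0 / 2 * b\<^sup>2
      + (\<epsilon> * Dmin / L\<^sup>2) / 4 * R\<^sup>2 + 1 * (2 * \<eta> * (a\<^sup>2 + b\<^sup>2) + \<mu> * (\<eta> * ((a\<^sup>2 + R\<^sup>2) / 2)))"
    using \<epsilon> \<eta>(1) \<mu> unfolding S_def
    by (intro add_mono mult_right_mono order_refl) (auto intro!: add_nonneg_nonneg mult_nonneg_nonneg)
  finally have E: "\<epsilon> * (- (h * a) + - (s * R) + b * m) \<le> \<dots>" .
  \<comment> \<open>\<open>k\<close> collects the errors common to \<open>a\<^sup>2\<close> and
    \<open>b\<^sup>2\<close>. The two further summands cover the mixed term of \<open>a\<close> and
    \<open>R\<close> from \<open>S4\<close>: \<open>\<mu> * \<eta>\<close> its part in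
    \<open>a\<^sup>2\<close>, and \<open>\<mu> * L\<^sup>2 * \<eta>\<close> its part in
    \<open>R\<^sup>2\<close>, whose admissible factor contains \<open>1 / L\<^sup>2\<close>.\<close>
  have kL: "k + \<mu> * \<eta> + \<mu> * L\<^sup>2 * \<eta> \<le> c0 / 4" "k + \<mu> * \<eta> + \<mu> * L\<^sup>2 * \<eta> \<le> \<epsilon> * Dmin / 4"
  proof -
    have "k + \<mu> * \<eta> + \<mu> * L\<^sup>2 * \<eta> = (\<gamma> + \<mu> + (1 + K3) + 2 + \<mu> + \<mu> * L\<^sup>2) * \<eta>"
      unfolding k_def by algebra
    then show "k + \<mu> * \<eta> + \<mu> * L\<^sup>2 * \<eta> \<le> c0 / 4" "k + \<mu> * \<eta> + \<mu> * L\<^sup>2 * \<eta> \<le> \<epsilon> * Dmin / 4"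
      using \<eta>(4) by linarith+
  qed
  have nn: "0 \<le> k" "0 \<le> \<mu> * \<eta>" "0 \<le> \<mu> * L\<^sup>2 * \<eta>"
    using \<eta>(1) \<mu> \<gamma> K3nn unfolding k_def by auto
  have "\<mu> * \<eta> / 2 \<le> (\<epsilon> * Dmin / L\<^sup>2) / 8"
  proof -
    have "\<mu> * \<eta> * L\<^sup>2 \<le> \<epsilon> * Dmin / 4" using kL(2) nn by (simp add: algebra_simps)
    then show ?thesis using L by (simp add: field_simps)
  qed
  then have r: "\<mu> * \<eta> / 2 * R\<^sup>2 \<le> (\<epsilon> * Dmin / L\<^sup>2) / 8 * R\<^sup>2" by (rule mult_right_mono) simp
  have a: "(k + \<mu> * \<eta> / 2) * a\<^sup>2 \<le> (\<epsilon> * Dmin / 4) * a\<^sup>2"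
    by (rule mult_right_mono[OF _ zero_le_power2]) (use kL nn in linarith)
  have b: "k * b\<^sup>2 \<le> c0 / 4 * b\<^sup>2"
    by (rule mult_right_mono[OF _ zero_le_power2]) (use kL nn in linarith)
  have "s * m + (\<rho>t * (1 / 2 * b\<^sup>2 + (P1 \<rho>h - P1 \<rho> - P2 \<rho> * (\<rho>h - \<rho>))) + vt * a * b)
      - \<epsilon> * h * a - \<epsilon> * s * R + \<epsilon> * b * m
    = s * m + (\<rho>t * (1 / 2 * b\<^sup>2 + (P1 \<rho>h - P1 \<rho> - P2 \<rho> * (\<rho>h - \<rho>))) + vt * a * b)
      + \<epsilon> * (- (h * a) + - (s * R) + b * m)"
    by (simp add: distrib_left right_diff_distrib)
  also have "\<dots> \<le> - c0 * b\<^sup>2 + (\<gamma> + \<mu>) * (\<eta> * (a\<^sup>2 + b\<^sup>2)) + (1 + K3) * (\<eta> * (a\<^sup>2 + b\<^sup>2))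
      + (- (\<epsilon> * Dmin) * a\<^sup>2 + c0 / 2 * b\<^sup>2
      + (\<epsilon> * Dmin / L\<^sup>2) / 4 * R\<^sup>2 + 1 * (2 * \<eta> * (a\<^sup>2 + b\<^sup>2) + \<mu> * (\<eta> * ((a\<^sup>2 + R\<^sup>2) / 2))))"
    by (rule add_mono[OF add_mono[OF S1 S2] E])
  also have "\<dots> = - (c0 / 2) * b\<^sup>2 - (\<epsilon> * Dmin) * a\<^sup>2 + (\<epsilon> * Dmin / L\<^sup>2) / 4 * R\<^sup>2
      + (k + \<mu> * \<eta> / 2) * a\<^sup>2 + k * b\<^sup>2 + \<mu> * \<eta> / 2 * R\<^sup>2"
    unfolding k_def by (simp add: field_simps)
  also have "\<dots> \<le> - (c0 / 2) * b\<^sup>2 - (\<epsilon> * Dmin) * a\<^sup>2 + (\<epsilon> * Dmin / L\<^sup>2) / 4 * R\<^sup>2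
      + (\<epsilon> * Dmin / 4) * a\<^sup>2 + c0 / 4 * b\<^sup>2 + (\<epsilon> * Dmin / L\<^sup>2) / 8 * R\<^sup>2"
    by (intro add_mono a b r order_refl)
  also have "\<dots> = 3 / 8 * (\<epsilon> * Dmin / L\<^sup>2) * R\<^sup>2 - 3 / 4 * (\<epsilon> * Dmin) * a\<^sup>2 - c0 / 4 * b\<^sup>2"
    by (simp add: algebra_simps)
  finally show ?thesis .
qed

end

section \<open>Energy decay on one edge\<close>

text \<open>The equations are assumed in iterated form, for almost every time and then for almost
  every point, because every argument fixes a time before it integrates in space. The bounds on the
  time derivatives sit in the same statement so that they concern the same derivatives.
  \<open>\<sigma>\<close> treats both kinds of measurement at once.\<close>

locale edge_pair = observer_bounds +
  fixes T l :: real and \<rho> v \<rho>h vh \<sigma> :: "real \<Rightarrow> real \<Rightarrow> real"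
  assumes l: "0 < l" "l \<le> L" and T: "0 < T"
    and Lip_state: "Lip ({0..T} \<times> {0..l}) (\<lambda>(t, x). \<rho> t x)" "Lip ({0..T} \<times> {0..l}) (\<lambda>(t, x). v t x)"
      "Lip ({0..T} \<times> {0..l}) (\<lambda>(t, x). \<rho>h t x)" "Lip ({0..T} \<times> {0..l}) (\<lambda>(t, x). vh t x)"
    and range: "\<And>t x. t \<in> {0..T} \<Longrightarrow> x \<in> {0..l} \<Longrightarrow> \<rho> t x \<in> {\<rho>min..\<rho>max}"
      "\<And>t x. t \<in> {0..T} \<Longrightarrow> x \<in> {0..l} \<Longrightarrow> \<rho>h t x \<in> {\<rho>min..\<rho>max}"
      "\<And>t x. t \<in> {0..T} \<Longrightarrow> x \<in> {0..l} \<Longrightarrow> \<bar>v t x\<bar> \<le> \<eta>"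
      "\<And>t x. t \<in> {0..T} \<Longrightarrow> x \<in> {0..l} \<Longrightarrow> \<bar>vh t x\<bar> \<le> \<eta>"
    and \<sigma>: "\<And>t x. \<sigma> t x = v t x - vh t x \<or> \<sigma> t x = \<rho> t x * v t x - \<rho>h t x * vh t x"
    and pde: "AE t in lebesgue. t \<in> {0<..<T} \<longrightarrow> (AE x in lebesgue. x \<in> {0<..<l} \<longrightarrow>
      (\<exists>\<rho>t mx vt hx \<rho>ht mhx vht hhx.
        ((\<lambda>s. \<rho> s x) has_real_derivative \<rho>t) (at t) \<and>
        ((\<lambda>x. \<rho> t x * v t x) has_real_derivative mx) (at x) \<and>
        ((\<lambda>s. v s x) has_real_derivative vt) (at t) \<and>
        ((\<lambda>x. 1 / 2 * (v t x)\<^sup>2 + P1 (\<rho> t x)) has_real_derivative hx) (at x) \<and>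
        ((\<lambda>s. \<rho>h s x) has_real_derivative \<rho>ht) (at t) \<and>
        ((\<lambda>x. \<rho>h t x * vh t x) has_real_derivative mhx) (at x) \<and>
        ((\<lambda>s. vh s x) has_real_derivative vht) (at t) \<and>
        ((\<lambda>x. 1 / 2 * (vh t x)\<^sup>2 + P1 (\<rho>h t x)) has_real_derivative hhx) (at x) \<and>
        \<rho>t + mx = 0 \<and> vt + hx = - \<gamma> * \<bar>v t x\<bar> * v t x \<and>
        \<rho>ht + mhx = 0 \<and> vht + hhx = - \<gamma> * \<bar>vh t x\<bar> * vh t x + \<mu> * \<sigma> t x \<and>
        \<bar>\<rho>t\<bar> \<le> \<eta> \<and> \<bar>vt\<bar> \<le> \<eta>))"
    and outflow: "\<And>t. t \<in> {0..T} \<Longrightarrow> \<rho> t l * v t l = \<rho>h t l * vh t l"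
begin

definition "d\<rho> t x = \<rho> t x - \<rho>h t x"
definition "dv t x = v t x - vh t x"
definition "dm t x = \<rho> t x * v t x - \<rho>h t x * vh t x"
definition "dh t x = 1 / 2 * (v t x)\<^sup>2 + P1 (\<rho> t x) - (1 / 2 * (vh t x)\<^sup>2 + P1 (\<rho>h t x))"
text \<open>The primitive is anchored at the boundary node, where the mass flows agree: no constant
  of integration appears in its time derivative, and \<open>R\<close> contributes no flux
  there.\<close>

definition "R t x = - integral {x..l} (d\<rho> t)"
definition "W t x = rel_energy (\<rho> t x) (v t x) (\<rho>h t x) (vh t x) - \<epsilon> * (dv t x * R t x)"
definition "N t = integral {0..l} (\<lambda>x. (d\<rho> t x)\<^sup>2 + (dv t x)\<^sup>2)"

abbreviation "Q \<equiv> {0..T} \<times> {0..l}"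

section \<open>Regularity of the difference quantities and of the corrected energy\<close>

lemma compact_Q: "compact Q"
  by (intro compact_Times compact_Icc)

lemma Lip_enthalpy_parts:
  "Lip Q (\<lambda>(t, x). P1 (\<rho> t x))" "Lip Q (\<lambda>(t, x). P1 (\<rho>h t x))"
  "Lip Q (\<lambda>(t, x). P (\<rho> t x))" "Lip Q (\<lambda>(t, x). P (\<rho>h t x))"
  using Lip_compose[OF Lip_state(1) Lip_P1] Lip_compose[OF Lip_state(3) Lip_P1]
    Lip_compose[OF Lip_state(1) Lip_P] Lip_compose[OF Lip_state(3) Lip_P] range(1,2)
  unfolding case_prod_unfold by (force+)

lemmas Lip_rules = Lip_mult[OF compact_Q] Lip_add Lip_diff Lip_const
  Lip_state[unfolded case_prod_unfold] Lip_enthalpy_parts[unfolded case_prod_unfold]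

lemma Lip_d\<rho>: "Lip Q (\<lambda>(t, x). d\<rho> t x)"
  unfolding d\<rho>_def case_prod_unfold by (intro Lip_rules)

lemma Lip_dv: "Lip Q (\<lambda>(t, x). dv t x)"
  unfolding dv_def case_prod_unfold by (intro Lip_rules)

lemma Lip_dm: "Lip Q (\<lambda>(t, x). dm t x)"
  unfolding dm_def case_prod_unfold by (intro Lip_rules)

lemma Lip_dh: "Lip Q (\<lambda>(t, x). dh t x)"
  unfolding dh_def case_prod_unfold power2_eq_square by (intro Lip_rules)

lemma Lip_R: "Lip Q (\<lambda>(t, x). R t x)"
  using Lip_diff[OF Lip_const[of _ 0] Lip_tail_integral[OF Lip_d\<rho>]]
  unfolding R_def case_prod_unfold by simp

lemma Lip_W: "Lip Q (\<lambda>(t, x). W t x)"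
  unfolding W_def rel_energy_def case_prod_unfold power2_eq_square divide_inverse
  by (intro Lip_rules Lip_R[unfolded case_prod_unfold] Lip_dv[unfolded case_prod_unfold])

lemma slice_continuous:
  assumes "t \<in> {0..T}"
  shows "continuous_on {0..l} (d\<rho> t)" "continuous_on {0..l} (dv t)" "continuous_on {0..l} (R t)"
    "continuous_on {0..l} (W t)"
  using Lip_continuous[OF Lip_slice[OF _ assms]] Lip_d\<rho> Lip_dv Lip_R Lip_W by blast+

lemma Lip_total:
  assumes "Lip Q (\<lambda>(t, x). f t x)"
  shows "Lip {0..T} (\<lambda>t. integral {0..l} (f t))"
  using Lip_slice2[OF Lip_tail_integral[OF assms], of 0] l by simp

text \<open>The length \<open>l\<close> is replaced by the common bound \<open>L\<close>, so that
  all edges share the same constants.\<close>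

lemma integral_R_square:
  assumes t: "t \<in> {0..T}"
  shows "integral {0..l} (\<lambda>x. (R t x)\<^sup>2) \<le> L\<^sup>2 * integral {0..l} (\<lambda>x. (d\<rho> t x)\<^sup>2)"
proof -
  note c = slice_continuous[OF t]
  have nn: "0 \<le> integral {0..l} (\<lambda>x. (d\<rho> t x)\<^sup>2)"
    by (intro integral_nonneg integrable_continuous_interval continuous_intros c) auto
  have "integral {0..l} (\<lambda>x. (R t x)\<^sup>2) \<le> integral {0..l} (\<lambda>x. l * integral {0..l} (\<lambda>x. (d\<rho> t x)\<^sup>2))"
    by (intro integral_le integrable_continuous_interval continuous_intros c)
      (auto simp: R_def intro!: tail_integral_square c)
  also have "\<dots> = l\<^sup>2 * integral {0..l} (\<lambda>x. (d\<rho> t x)\<^sup>2)"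
    using l by (simp add: power2_eq_square)
  also have "\<dots> \<le> L\<^sup>2 * integral {0..l} (\<lambda>x. (d\<rho> t x)\<^sup>2)"
    using l nn by (intro mult_right_mono power_mono) auto
  finally show ?thesis .
qed

lemma N_eq:
  assumes t: "t \<in> {0..T}"
  shows "N t = integral {0..l} (\<lambda>x. (d\<rho> t x)\<^sup>2) + integral {0..l} (\<lambda>x. (dv t x)\<^sup>2)"
  unfolding N_def
  by (intro integral_add integrable_continuous_interval continuous_intros slice_continuous[OF t])

text \<open>The relative energy keeps at least a quarter of \<open>\<kappa>\<close> since
  \<open>\<eta>\<close> is at most half of it. The correction costs at most
  \<open>\<kappa> / 8\<close>, by the condition on \<open>\<epsilon> * (1 + L\<^sup>2)\<close>, but
  only in the integral, as \<open>R\<close> is nonlocal.\<close>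

lemma energy_bounds:
  assumes t: "t \<in> {0..T}"
  shows "min \<rho>min Dmin / 8 * N t \<le> integral {0..l} (W t)"
    and "integral {0..l} (W t) \<le> ((max \<rho>max Dmax + 1) / 2 + min \<rho>min Dmin / 8) * N t"
proof -
  define \<kappa> where "\<kappa> = min \<rho>min Dmin"
  note c = slice_continuous[OF t]
  note ci = integrable_continuous_interval continuous_intros c
  define A B S where "A = integral {0..l} (\<lambda>x. (d\<rho> t x)\<^sup>2)" and "B = integral {0..l} (\<lambda>x. (dv t x)\<^sup>2)"
    and "S = integral {0..l} (\<lambda>x. (R t x)\<^sup>2)"
  have AB: "N t = A + B" unfolding A_def B_def by (rule N_eq[OF t])
  have A0: "0 \<le> A" "0 \<le> B" unfolding A_def B_def by (intro integral_nonneg ci; simp)+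
  have SA: "S \<le> L\<^sup>2 * A" unfolding S_def A_def by (rule integral_R_square[OF t])
  have iA: "((\<lambda>x. (d\<rho> t x)\<^sup>2) has_integral A) {0..l}" unfolding A_def by (intro integrable_integral ci)
  have iB: "((\<lambda>x. (dv t x)\<^sup>2) has_integral B) {0..l}" unfolding B_def by (intro integrable_integral ci)
  have iS: "((\<lambda>x. (R t x)\<^sup>2) has_integral S) {0..l}" unfolding S_def by (intro integrable_integral ci)
  have iW: "(W t has_integral integral {0..l} (W t)) {0..l}" by (intro integrable_integral ci)
  have cross: "\<bar>\<epsilon> * (dv t x * R t x)\<bar> \<le> \<epsilon> / 2 * ((dv t x)\<^sup>2 + (R t x)\<^sup>2)" for x
    using mult_left_mono[OF abs_mult_le_squares[of "dv t x" "R t x"], of \<epsilon>] \<epsilon>(1)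
    by (simp add: abs_mult)
  have lo: "\<kappa> / 4 * ((d\<rho> t x)\<^sup>2 + (dv t x)\<^sup>2) - \<epsilon> / 2 * ((dv t x)\<^sup>2 + (R t x)\<^sup>2) \<le> W t x" if "x \<in> {0..l}" for x
  proof -
    have "\<kappa> / 4 * ((d\<rho> t x)\<^sup>2 + (dv t x)\<^sup>2) \<le> (\<kappa> - \<eta>) / 2 * ((d\<rho> t x)\<^sup>2 + (dv t x)\<^sup>2)"
      using \<eta>(3) by (intro mult_right_mono) (auto simp: \<kappa>_def)
    also have "\<dots> \<le> rel_energy (\<rho> t x) (v t x) (\<rho>h t x) (vh t x)"
      unfolding \<kappa>_def d\<rho>_def dv_def by (intro rel_energy_bounds range t that)
    finally show ?thesis unfolding W_def using cross[of x] by linarith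
  qed
  have up: "W t x \<le> (max \<rho>max Dmax + 1) / 2 * ((d\<rho> t x)\<^sup>2 + (dv t x)\<^sup>2) + \<epsilon> / 2 * ((dv t x)\<^sup>2 + (R t x)\<^sup>2)"
    if "x \<in> {0..l}" for x
  proof -
    have "rel_energy (\<rho> t x) (v t x) (\<rho>h t x) (vh t x) \<le> (max \<rho>max Dmax + \<eta>) / 2 * ((d\<rho> t x)\<^sup>2 + (dv t x)\<^sup>2)"
      unfolding d\<rho>_def dv_def by (intro rel_energy_bounds range t that)
    also have "\<dots> \<le> (max \<rho>max Dmax + 1) / 2 * ((d\<rho> t x)\<^sup>2 + (dv t x)\<^sup>2)"
      using \<eta>(2) by (intro mult_right_mono) auto
    finally show ?thesis unfolding W_def using cross[of x] by linarith
  qed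
  have "\<kappa> / 4 * (A + B) - \<epsilon> / 2 * (B + S) \<le> integral {0..l} (W t)"
    by (rule has_integral_le[OF _ iW lo])
      (intro has_integral_add has_integral_diff has_integral_mult_right iA iB iS)
  moreover have "integral {0..l} (W t) \<le> (max \<rho>max Dmax + 1) / 2 * (A + B) + \<epsilon> / 2 * (B + S)"
    by (rule has_integral_le[OF iW _ up])
      (intro has_integral_add has_integral_mult_right iA iB iS)
  moreover have "\<epsilon> / 2 * (B + S) \<le> \<kappa> / 8 * (A + B)"
  proof -
    have "B + S \<le> (1 + L\<^sup>2) * (A + B)"
    proof -
      have "0 \<le> L\<^sup>2 * B" using A0 by simp
      moreover have "(1 + L\<^sup>2) * (A + B) = B + L\<^sup>2 * A + (A + L\<^sup>2 * B)" by algebra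
      ultimately show ?thesis using SA A0 by linarith
    qed
    then have "\<epsilon> * (B + S) \<le> \<epsilon> * ((1 + L\<^sup>2) * (A + B))" using \<epsilon>(1) by (intro mult_left_mono) auto
    also have "\<dots> \<le> (\<kappa> / 4) * (A + B)"
      using mult_right_mono[OF \<epsilon>(4), of "A + B"] A0 by (simp add: \<kappa>_def mult.assoc)
    finally show ?thesis by simp
  qed
  ultimately have 1: "\<kappa> / 8 * (A + B) \<le> integral {0..l} (W t)"
    and 2: "integral {0..l} (W t) \<le> (max \<rho>max Dmax + 1) / 2 * (A + B) + \<kappa> / 8 * (A + B)"
    by linarith+
  show "min \<rho>min Dmin / 8 * N t \<le> integral {0..l} (W t)" using 1 unfolding AB \<kappa>_def .
  show "integral {0..l} (W t) \<le> ((max \<rho>max Dmax + 1) / 2 + min \<rho>min Dmin / 8) * N t"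
    using 2 unfolding AB \<kappa>_def distrib_right .
qed

text \<open>The exceptional set of times is the same for all \<open>x\<close>, because the equation
  is first fixed at a time and only then integrated over \<open>{x..l}\<close>. This uniformity
  allows \<open>R\<close> to be differentiated in time inside the energy balance.\<close>

lemma mass_rate:
  "AE t in lebesgue. t \<in> {0<..<T} \<longrightarrow>
    (\<forall>x\<in>{0..l}. ((\<lambda>s. integral {x..l} (d\<rho> s)) has_real_derivative dm t x) (at t))"
  using pde
proof (eventually_elim, intro impI ballI, goal_cases)
  case (1 t x)
  then have t: "t \<in> {0<..<T}" and x: "x \<in> {0..l}" by auto
  note ae = 1(1)[rule_format, OF t]
  have t': "t \<in> {0..T}" using t by auto
  have "((\<lambda>s. integral {x..l} (d\<rho> s)) has_real_derivative dm t x - dm t l) (at t)"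
  proof (rule balance_equation[OF t x Lip_d\<rho> Lip_slice[OF Lip_dm t']])
    show "AE x in lebesgue. x \<in> {0<..<l} \<longrightarrow> (\<exists>wt bx. ((\<lambda>s. d\<rho> s x) has_real_derivative wt) (at t) \<and>
      (dm t has_real_derivative bx) (at x) \<and> wt + bx = 0)"
      using ae
    proof (eventually_elim, intro impI, goal_cases)
      case (1 x)
      then obtain \<rho>t mx \<rho>ht mhx where
        "((\<lambda>s. \<rho> s x) has_real_derivative \<rho>t) (at t)" "((\<lambda>x. \<rho> t x * v t x) has_real_derivative mx) (at x)"
        "((\<lambda>s. \<rho>h s x) has_real_derivative \<rho>ht) (at t)" "((\<lambda>x. \<rho>h t x * vh t x) has_real_derivative mhx) (at x)"
        "\<rho>t + mx = 0" "\<rho>ht + mhx = 0" by blast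
      then show ?case
        unfolding d\<rho>_def dm_def[abs_def]
        by (intro exI[of _ "\<rho>t - \<rho>ht"] exI[of _ "mx - mhx"]) (auto intro: DERIV_diff)
    qed
  qed
  then show "((\<lambda>s. integral {x..l} (d\<rho> s)) has_real_derivative dm t x) (at t)"
    using outflow[OF t'] by (simp add: dm_def)
qed

text \<open>The rates of the differences multiply exactly \<open>dh\<close> and \<open>dm\<close>,
  which pairs them with the derivative of the flux \<open>dm * dh\<close>. The remainder is
  quadratic in the differences, and the only rates in it are \<open>rt\<close> and
  \<open>ut\<close>, those of the original solution.\<close>

lemma rel_energy_derivative:
  fixes r u rh uh :: "real \<Rightarrow> real"
  assumes d: "(r has_real_derivative rt) (at t)" "(u has_real_derivative ut) (at t)"
    "(rh has_real_derivative rht) (at t)" "(uh has_real_derivative uht) (at t)"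
    and pos: "0 < r t" "0 < rh t"
  shows "((\<lambda>s. rel_energy (r s) (u s) (rh s) (uh s)) has_real_derivative
    (rt - rht) * (1 / 2 * (u t)\<^sup>2 + P1 (r t) - (1 / 2 * (uh t)\<^sup>2 + P1 (rh t))) +
    (ut - uht) * (r t * u t - rh t * uh t) +
    (rt * (1 / 2 * (u t - uh t)\<^sup>2 + (P1 (rh t) - P1 (r t) - P2 (r t) * (rh t - r t))) +
      ut * (r t - rh t) * (u t - uh t))) (at t)"
  unfolding rel_energy_def
  by (rule derivative_eq_intros DERIV_chain2[OF P1] DERIV_chain2[OF P2] d pos refl | simp)+
    (simp add: power2_eq_square field_simps)

lemma energy_rate:
  "AE t in lebesgue. t \<in> {0<..<T} \<longrightarrow>
    (\<exists>D. ((\<lambda>s. integral {0..l} (W s)) has_real_derivative D) (at t) \<and>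
      D \<le> - min (3 / 8 * (\<epsilon> * Dmin)) (c0 / 4) * N t + dh t 0 * (dm t 0 - \<epsilon> * R t 0))"
  using pde mass_rate
proof (eventually_elim, intro impI, goal_cases)
  case (1 t)
  then have t: "t \<in> {0<..<T}" and t': "t \<in> {0..T}" by auto
  note ae = 1(1)[rule_format, OF t] and mass = 1(2)[rule_format, OF t]
  note c = slice_continuous[OF t']
  \<comment> \<open>The total flux: the product of mass flow and enthalpy differences, together with
    the flux of the correction.\<close>
  define b where "b x = dm t x * dh t x - \<epsilon> * (dh t x * R t x)" for x
  define q where "q x = 3 / 8 * (\<epsilon> * Dmin / L\<^sup>2) * (R t x)\<^sup>2 - 3 / 4 * (\<epsilon> * Dmin) * (d\<rho> t x)\<^sup>2
      - c0 / 4 * (dv t x)\<^sup>2" for x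
  have b: "Lip {0..l} b"
    unfolding b_def by (intro Lip_diff Lip_mult compact_Icc Lip_const
      Lip_slice[OF Lip_dm t'] Lip_slice[OF Lip_dh t'] Lip_slice[OF Lip_R t'])
  have q: "continuous_on {0..l} q"
    unfolding q_def by (intro continuous_intros c)
  have "\<exists>D. ((\<lambda>s. integral {0..l} (W s)) has_real_derivative D) (at t) \<and>
      D \<le> integral {0..l} q + b 0 - b l"
  proof (rule balance_inequality[OF t _ Lip_W b q])
    show "AE x in lebesgue. x \<in> {0<..<l} \<longrightarrow> (\<exists>wt bx. ((\<lambda>s. W s x) has_real_derivative wt) (at t) \<and>
      (b has_real_derivative bx) (at x) \<and> wt + bx \<le> q x)"
      using ae
    proof (eventually_elim, intro impI, goal_cases)
      case (1 x)
      then have x: "x \<in> {0<..<l}" and x': "x \<in> {0..l}" by auto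
      from 1 obtain \<rho>t mx vt hx \<rho>ht mhx vht hhx where
        d: "((\<lambda>s. \<rho> s x) has_real_derivative \<rho>t) (at t)" "((\<lambda>s. v s x) has_real_derivative vt) (at t)"
          "((\<lambda>s. \<rho>h s x) has_real_derivative \<rho>ht) (at t)" "((\<lambda>s. vh s x) has_real_derivative vht) (at t)"
        and dx: "((\<lambda>x. \<rho> t x * v t x) has_real_derivative mx) (at x)"
          "((\<lambda>x. \<rho>h t x * vh t x) has_real_derivative mhx) (at x)"
          "((\<lambda>x. 1 / 2 * (v t x)\<^sup>2 + P1 (\<rho> t x)) has_real_derivative hx) (at x)"
          "((\<lambda>x. 1 / 2 * (vh t x)\<^sup>2 + P1 (\<rho>h t x)) has_real_derivative hhx) (at x)"
        and eq: "\<rho>t + mx = 0" "vt + hx = - \<gamma> * \<bar>v t x\<bar> * v t x"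
          "\<rho>ht + mhx = 0" "vht + hhx = - \<gamma> * \<bar>vh t x\<bar> * vh t x + \<mu> * \<sigma> t x"
        and small: "\<bar>\<rho>t\<bar> \<le> \<eta>" "\<bar>vt\<bar> \<le> \<eta>" by blast
      have dR: "((\<lambda>s. R s x) has_real_derivative - dm t x) (at t)"
        unfolding R_def using mass x' by (intro DERIV_minus) auto
      have dRx: "(R t has_real_derivative d\<rho> t x) (at x)"
        using DERIV_minus[OF has_real_derivative_tail_integral[OF c(1) x]]
        unfolding R_def[abs_def] by simp
      have ddm: "(dm t has_real_derivative (mx - mhx)) (at x)"
        unfolding dm_def[abs_def] by (intro DERIV_diff dx)
      have ddh: "(dh t has_real_derivative (hx - hhx)) (at x)"
        unfolding dh_def[abs_def] by (intro DERIV_diff dx)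
      have ddv: "((\<lambda>s. dv s x) has_real_derivative (vt - vht)) (at t)"
        unfolding dv_def by (intro DERIV_diff d)
      define rem where "rem = \<rho>t * (1 / 2 * (v t x - vh t x)\<^sup>2 +
        (P1 (\<rho>h t x) - P1 (\<rho> t x) - P2 (\<rho> t x) * (\<rho>h t x - \<rho> t x))) + vt * (\<rho> t x - \<rho>h t x) * (v t x - vh t x)"
      define wt where "wt = (\<rho>t - \<rho>ht) * dh t x + (vt - vht) * dm t x + rem
        - \<epsilon> * ((vt - vht) * R t x + - dm t x * dv t x)"
      define bx where "bx = ((mx - mhx) * dh t x + (hx - hhx) * dm t x)
        - \<epsilon> * ((hx - hhx) * R t x + d\<rho> t x * dh t x)"
      have pos: "0 < \<rho> t x" "0 < \<rho>h t x" using range(1,2)[OF t' x'] \<rho>min by auto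
      have "((\<lambda>s. W s x) has_real_derivative wt) (at t)"
        unfolding W_def wt_def rem_def dh_def[of t x] dm_def[of t x]
        by (intro DERIV_diff DERIV_cmult DERIV_mult' rel_energy_derivative d pos
            DERIV_mult[OF ddv dR[unfolded dm_def]])
      moreover have "(b has_real_derivative bx) (at x)"
        unfolding b_def[abs_def] bx_def
        by (intro DERIV_diff DERIV_cmult DERIV_mult ddm ddh dRx)
      moreover have "wt + bx \<le> q x"
      proof -
        define s where "s = - \<gamma> * (\<bar>v t x\<bar> * v t x - \<bar>vh t x\<bar> * vh t x) - \<mu> * \<sigma> t x"
        have "vt - vht + (hx - hhx) = s" using eq unfolding s_def by (simp add: algebra_simps)
        then have hx: "hx - hhx = s - (vt - vht)" by simp
        have mx: "mx - mhx = - (\<rho>t - \<rho>ht)" using eq by simp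
        \<comment> \<open>The mass equations cancel the rates multiplied by \<open>dh\<close>. The
          momentum equations combine the rates of \<open>dv\<close> with the gradient of
          \<open>dh\<close> into \<open>s\<close>, multiplied by
          \<open>dm t x - \<epsilon> * R t x\<close>.\<close>
        have "wt + bx = s * dm t x + rem - \<epsilon> * dh t x * d\<rho> t x - \<epsilon> * s * R t x + \<epsilon> * dv t x * dm t x"
          unfolding wt_def bx_def hx mx by (simp add: algebra_simps)
        also have "\<dots> \<le> q x"
          unfolding s_def rem_def q_def d\<rho>_def dv_def dm_def dh_def
          by (rule dissipation_pointwise) (use range t' x' small \<sigma>[of t x] in auto)
        finally show ?thesis .
      qed
      ultimately show ?case by blast
    qed
  qed (use l in auto)
  then obtain D where D: "((\<lambda>s. integral {0..l} (W s)) has_real_derivative D) (at t)"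
    "D \<le> integral {0..l} q + b 0 - b l" by blast
  have "dm t l = 0" using outflow[OF t'] by (simp add: dm_def)
  moreover have "R t l = 0" by (simp add: R_def)
  ultimately have bl: "b l = 0" by (simp add: b_def)
  have b0: "b 0 = dh t 0 * (dm t 0 - \<epsilon> * R t 0)" by (simp add: b_def algebra_simps)
  define A B S where "A = integral {0..l} (\<lambda>x. (d\<rho> t x)\<^sup>2)" and "B = integral {0..l} (\<lambda>x. (dv t x)\<^sup>2)"
    and "S = integral {0..l} (\<lambda>x. (R t x)\<^sup>2)"
  note ci = integrable_continuous_interval continuous_intros c
  have A0: "0 \<le> A" "0 \<le> B" unfolding A_def B_def by (intro integral_nonneg ci; simp)+
  have "(q has_integral (3 / 8 * (\<epsilon> * Dmin / L\<^sup>2) * S - 3 / 4 * (\<epsilon> * Dmin) * A - c0 / 4 * B)) {0..l}"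
    unfolding q_def A_def B_def S_def
    by (intro has_integral_diff has_integral_mult_right integrable_integral ci)
  then have "integral {0..l} q = 3 / 8 * (\<epsilon> * Dmin / L\<^sup>2) * S - 3 / 4 * (\<epsilon> * Dmin) * A - c0 / 4 * B"
    by (rule integral_unique)
  \<comment> \<open>The factor \<open>1 / L\<^sup>2\<close> compensates the constant of the tail
    estimate, so half of the density damping remains.\<close>
  also have "3 / 8 * (\<epsilon> * Dmin / L\<^sup>2) * S \<le> 3 / 8 * (\<epsilon> * Dmin / L\<^sup>2) * (L\<^sup>2 * A)"
    unfolding S_def A_def using \<epsilon>(1) Dmin(1) by (intro mult_left_mono integral_R_square[OF t']) auto
  also have "3 / 8 * (\<epsilon> * Dmin / L\<^sup>2) * (L\<^sup>2 * A) = 3 / 8 * (\<epsilon> * Dmin) * A"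
    using L by simp
  finally have "integral {0..l} q \<le> - (3 / 8 * (\<epsilon> * Dmin)) * A - c0 / 4 * B" by (simp add: algebra_simps)
  also have "\<dots> \<le> - min (3 / 8 * (\<epsilon> * Dmin)) (c0 / 4) * N t"
  proof -
    have "min (3 / 8 * (\<epsilon> * Dmin)) (c0 / 4) * A \<le> 3 / 8 * (\<epsilon> * Dmin) * A"
      "min (3 / 8 * (\<epsilon> * Dmin)) (c0 / 4) * B \<le> c0 / 4 * B"
      using A0 by (intro mult_right_mono; simp)+
    moreover have "N t = A + B" unfolding A_def B_def by (rule N_eq[OF t'])
    ultimately show ?thesis by (simp add: distrib_left)
  qed
  finally show ?case using D bl b0 by (intro exI[of _ D]) auto
qed

text \<open>The interface to the network: \<open>W\<close> and \<open>R\<close> are hidden, and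
  \<open>- \<epsilon> * R t 0\<close> appears as \<open>\<epsilon>\<close> times the mass difference
  on the edge, ready for summation over all edges.\<close>

lemma edge_energy:
  obtains E where "Lip {0..T} E"
    "\<And>t. t \<in> {0..T} \<Longrightarrow> min \<rho>min Dmin / 8 *
      integral {0..l} (\<lambda>x. (\<rho> t x - \<rho>h t x)\<^sup>2 + (v t x - vh t x)\<^sup>2) \<le> E t"
    "\<And>t. t \<in> {0..T} \<Longrightarrow> E t \<le> ((max \<rho>max Dmax + 1) / 2 + min \<rho>min Dmin / 8) *
      integral {0..l} (\<lambda>x. (\<rho> t x - \<rho>h t x)\<^sup>2 + (v t x - vh t x)\<^sup>2)"
    "AE t in lebesgue. t \<in> {0<..<T} \<longrightarrow> (\<exists>D. (E has_real_derivative D) (at t) \<and>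
      D \<le> - min (3 / 8 * (\<epsilon> * Dmin)) (c0 / 4) *
          integral {0..l} (\<lambda>x. (\<rho> t x - \<rho>h t x)\<^sup>2 + (v t x - vh t x)\<^sup>2) +
        (1 / 2 * (v t 0)\<^sup>2 + P1 (\<rho> t 0) - (1 / 2 * (vh t 0)\<^sup>2 + P1 (\<rho>h t 0))) *
        (\<rho> t 0 * v t 0 - \<rho>h t 0 * vh t 0 + \<epsilon> * integral {0..l} (\<lambda>x. \<rho> t x - \<rho>h t x)))"
proof (rule that[of "\<lambda>t. integral {0..l} (W t)"])
  show "Lip {0..T} (\<lambda>t. integral {0..l} (W t))" by (rule Lip_total[OF Lip_W])
  have N: "integral {0..l} (\<lambda>x. (\<rho> t x - \<rho>h t x)\<^sup>2 + (v t x - vh t x)\<^sup>2) = N t" for t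
    by (simp add: N_def d\<rho>_def dv_def)
  show "min \<rho>min Dmin / 8 * integral {0..l} (\<lambda>x. (\<rho> t x - \<rho>h t x)\<^sup>2 + (v t x - vh t x)\<^sup>2)
      \<le> integral {0..l} (W t)" if "t \<in> {0..T}" for t
    unfolding N by (rule energy_bounds[OF that])
  show "integral {0..l} (W t) \<le> ((max \<rho>max Dmax + 1) / 2 + min \<rho>min Dmin / 8) *
      integral {0..l} (\<lambda>x. (\<rho> t x - \<rho>h t x)\<^sup>2 + (v t x - vh t x)\<^sup>2)" if "t \<in> {0..T}" for t
    unfolding N by (rule energy_bounds[OF that])
  have R: "\<rho> t 0 * v t 0 - \<rho>h t 0 * vh t 0 + \<epsilon> * integral {0..l} (\<lambda>x. \<rho> t x - \<rho>h t x)
      = dm t 0 - \<epsilon> * R t 0" for t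
    by (simp add: dm_def R_def d\<rho>_def[abs_def])
  show "AE t in lebesgue. t \<in> {0<..<T} \<longrightarrow> (\<exists>D. ((\<lambda>t. integral {0..l} (W t)) has_real_derivative D) (at t) \<and>
      D \<le> - min (3 / 8 * (\<epsilon> * Dmin)) (c0 / 4) *
          integral {0..l} (\<lambda>x. (\<rho> t x - \<rho>h t x)\<^sup>2 + (v t x - vh t x)\<^sup>2) +
        (1 / 2 * (v t 0)\<^sup>2 + P1 (\<rho> t 0) - (1 / 2 * (vh t 0)\<^sup>2 + P1 (\<rho>h t 0))) *
        (\<rho> t 0 * v t 0 - \<rho>h t 0 * vh t 0 + \<epsilon> * integral {0..l} (\<lambda>x. \<rho> t x - \<rho>h t x)))"
    unfolding N R using energy_rate[unfolded dh_def] .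
qed

lemma edge_mass:
  "Lip {0..T} (\<lambda>t. integral {0..l} (\<lambda>x. \<rho> t x - \<rho>h t x))"
  "AE t in lebesgue. t \<in> {0<..<T} \<longrightarrow> ((\<lambda>t. integral {0..l} (\<lambda>x. \<rho> t x - \<rho>h t x))
    has_real_derivative \<rho> t 0 * v t 0 - \<rho>h t 0 * vh t 0) (at t)"
  using Lip_total[OF Lip_d\<rho>] mass_rate l
  unfolding d\<rho>_def[abs_def] dm_def by (auto elim!: eventually_mono)

text \<open>This bound is the factor in front of the mass difference and thus enters
  \<open>C3\<close>.\<close>

lemma inlet_enthalpy_bound:
  assumes t: "t \<in> {0..T}" and B: "\<And>r. r \<in> {\<rho>min..\<rho>max} \<Longrightarrow> \<bar>P1 r\<bar> \<le> B"
  shows "\<bar>1 / 2 * (v t 0)\<^sup>2 + P1 (\<rho> t 0) - (1 / 2 * (vh t 0)\<^sup>2 + P1 (\<rho>h t 0))\<bar> \<le> 1 + 2 * B"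
proof -
  have 0: "0 \<in> {0..l}" using l by simp
  have "(v t 0)\<^sup>2 \<le> 1" "(vh t 0)\<^sup>2 \<le> 1"
    using range(3,4)[OF t 0] \<eta>(2) by (auto simp: abs_square_le_1)
  then show ?thesis
    using B[OF range(1)[OF t 0]] B[OF range(2)[OF t 0]] zero_le_power2[of "v t 0"] zero_le_power2[of "vh t 0"]
    by (simp only: abs_le_iff) linarith
qed

end

section \<open>The star network\<close>

text \<open>Distances and masses are defined by Lebesgue integrals over open intervals, whereas the
  estimates use gauge integrals over closed ones.\<close>

lemma LINT_lebesgue_on_interval:
  fixes f :: "real \<Rightarrow> real"
  assumes "continuous_on {0..l} f"
  shows "(LINT x|lebesgue_on {0<..<l}. f x) = integral {0..l} f"
proof -
  have "integrable (lebesgue_on {0..l}) f"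
    by (rule continuous_imp_integrable_real[OF assms])
  then have "set_integrable lebesgue {0..l} f"
    by (simp add: integrable_restrict_space set_integrable_def)
  then have "set_integrable lebesgue {0<..<l} f"
    by (rule set_integrable_subset) auto
  then have "integrable (lebesgue_on {0<..<l}) f"
    by (simp add: integrable_restrict_space set_integrable_def)
  then have "(LINT x|lebesgue_on {0<..<l}. f x) = integral {0<..<l} f"
    by (rule lebesgue_integral_eq_integral) simp
  also have "\<dots> = integral {0..l} f"
    by (rule integral_open_interval_real[symmetric])
  finally show ?thesis .
qed

section \<open>Verification of the assumptions on a single edge\<close>

definition measured_difference ::
  "measurement \<Rightarrow> (real \<Rightarrow> real \<Rightarrow> real) \<Rightarrow> (real \<Rightarrow> real \<Rightarrow> real) \<Rightarrow>
   (real \<Rightarrow> real \<Rightarrow> real) \<Rightarrow> (real \<Rightarrow> real \<Rightarrow> real) \<Rightarrow> real \<Rightarrow> real \<Rightarrow> real" where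
  "measured_difference meas \<rho> v \<rho>h vh t x = (case meas of
     Velocity_Measurement \<Rightarrow> v t x - vh t x
   | Mass_Flow_Measurement \<Rightarrow> \<rho> t x * v t x - \<rho>h t x * vh t x)"

lemma source_v_eq: "source_v meas \<mu> \<rho> v \<rho>h vh t x = \<mu> * measured_difference meas \<rho> v \<rho>h vh t x"
  by (cases meas) (simp_all add: measured_difference_def mass_flow_def)

lemma Linf_norm_AE:
  assumes "Linf_norm S f \<le> ereal c"
  shows "AE z in lebesgue_on S. \<bar>f z\<bar> \<le> c"
  using esssup_AE[of "\<lambda>z. ereal \<bar>f z\<bar>" "lebesgue_on S"] assms unfolding Linf_norm_def
  by (auto elim!: eventually_mono dest: order_trans)

text \<open>A negative essential supremum would make the nonempty open rectangle a null set.
  Nonnegativity is what allows the bound on the sum of two norms in (A4) to be used for each norm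
  separately.\<close>

lemma Linf_norm_nonneg:
  fixes T l :: real
  assumes "0 < T" "0 < l"
  shows "0 \<le> Linf_norm (rect T l) f"
proof (rule ccontr)
  assume "\<not> 0 \<le> Linf_norm (rect T l) f"
  then have neg: "Linf_norm (rect T l) f < 0" by simp
  have oU: "open (rect T l)" unfolding rect_def by (intro open_Times) auto
  have S: "rect T l \<in> sets lebesgue" using oU by (intro sets_completionI_sets) simp
  have "AE z in lebesgue_on (rect T l). ereal \<bar>f z\<bar> \<le> Linf_norm (rect T l) f"
    unfolding Linf_norm_def by (rule esssup_AE)
  then have "AE z in lebesgue_on (rect T l). False"
    by (rule eventually_mono) (use neg in \<open>meson abs_ge_zero ereal_less_eq(5) leD order_le_less_trans\<close>)
  then have "AE z in lebesgue. z \<notin> rect T l"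
    using S by (simp add: AE_restrict_space_iff)
  then have "negligible (rect T l)"
    unfolding eventually_ae_filter_negligible by (auto intro: negligible_subset)
  moreover have "rect T l \<noteq> {}" unfolding rect_def using dense[OF assms(1)] dense[OF assms(2)] by auto
  ultimately show False using open_not_negligible[OF oU] by blast
qed

lemma regular_imp_Lip: "regular T L u \<Longrightarrow> Lip ({0..T} \<times> {0..L}) (\<lambda>(t, x). u t x)"
  unfolding regular_def Lip_def by blast

lemma edge_pairI:
  fixes T l :: real
  assumes bounds: "observer_bounds P (deriv P) P2 P3 \<rho>min \<rho>max Dmin Dmax K3 \<gamma> \<mu> L \<epsilon> \<eta> c0"
    and l: "0 < l" "l \<le> L" and T: "0 < T"
    and orig: "original_system P \<gamma> T l \<rho> v"
    and obs: "observer_system P \<gamma> meas \<mu> T l \<rho> v \<rho>h vh"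
    and reg: "regular T l \<rho>" "regular T l v" "regular T l \<rho>h" "regular T l vh"
    and range: "\<And>t x. t \<in> {0..T} \<Longrightarrow> x \<in> {0..l} \<Longrightarrow>
      \<rho>min \<le> \<rho> t x \<and> \<rho> t x \<le> \<rho>max \<and> \<rho>min \<le> \<rho>h t x \<and> \<rho>h t x \<le> \<rho>max"
    and time: "Linf_norm (rect T l) (\<lambda>(t, x). deriv (\<lambda>s. \<rho> s x) t) +
      Linf_norm (rect T l) (\<lambda>(t, x). deriv (\<lambda>s. v s x) t) \<le> ereal \<eta>"
    and vel: "Linf_norm (rect T l) (\<lambda>(t, x). v t x) \<le> ereal \<eta>"
      "Linf_norm (rect T l) (\<lambda>(t, x). vh t x) \<le> ereal \<eta>"
    and outflow: "\<And>t. t \<in> {0..T} \<Longrightarrow> \<rho> t l * v t l = \<rho>h t l * vh t l"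
  shows "edge_pair P (deriv P) P2 P3 \<rho>min \<rho>max Dmin Dmax K3 \<gamma> \<mu> L \<epsilon> \<eta> c0 T l \<rho> v \<rho>h vh
    (measured_difference meas \<rho> v \<rho>h vh)"
proof (intro edge_pair.intro bounds edge_pair_axioms.intro)
  let ?N\<rho> = "Linf_norm (rect T l) (\<lambda>(t, x). deriv (\<lambda>s. \<rho> s x) t)"
  let ?Nv = "Linf_norm (rect T l) (\<lambda>(t, x). deriv (\<lambda>s. v s x) t)"
  have "?N\<rho> \<le> ?N\<rho> + ?Nv" "?Nv \<le> ?N\<rho> + ?Nv"
    using Linf_norm_nonneg[OF T l(1)] by (simp_all add: add_increasing add_increasing2)
  then have "?N\<rho> \<le> ereal \<eta>" "?Nv \<le> ereal \<eta>"
    using time by (blast intro: order_trans)+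
  note small = this[THEN Linf_norm_AE]
  show "AE t in lebesgue. t \<in> {0<..<T} \<longrightarrow> (AE x in lebesgue. x \<in> {0<..<l} \<longrightarrow>
      (\<exists>\<rho>t mx vt hx \<rho>ht mhx vht hhx.
        ((\<lambda>s. \<rho> s x) has_real_derivative \<rho>t) (at t) \<and>
        ((\<lambda>x. \<rho> t x * v t x) has_real_derivative mx) (at x) \<and>
        ((\<lambda>s. v s x) has_real_derivative vt) (at t) \<and>
        ((\<lambda>x. 1 / 2 * (v t x)\<^sup>2 + deriv P (\<rho> t x)) has_real_derivative hx) (at x) \<and>
        ((\<lambda>s. \<rho>h s x) has_real_derivative \<rho>ht) (at t) \<and>
        ((\<lambda>x. \<rho>h t x * vh t x) has_real_derivative mhx) (at x) \<and>
        ((\<lambda>s. vh s x) has_real_derivative vht) (at t) \<and>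
        ((\<lambda>x. 1 / 2 * (vh t x)\<^sup>2 + deriv P (\<rho>h t x)) has_real_derivative hhx) (at x) \<and>
        \<rho>t + mx = 0 \<and> vt + hx = - \<gamma> * \<bar>v t x\<bar> * v t x \<and>
        \<rho>ht + mhx = 0 \<and> vht + hhx = - \<gamma> * \<bar>vh t x\<bar> * vh t x
          + \<mu> * measured_difference meas \<rho> v \<rho>h vh t x \<and>
        \<bar>\<rho>t\<bar> \<le> \<eta> \<and> \<bar>vt\<bar> \<le> \<eta>))" (is "AE t in lebesgue. _ \<longrightarrow> (AE x in lebesgue. _ \<longrightarrow> ?Q t x)")
  proof -
    have "AE z in lebesgue_on (rect T l). case z of (t, x) \<Rightarrow> ?Q t x"
      using orig[unfolded original_system_def solves_system_def]
        obs[unfolded observer_system_def solves_system_def source_v_eq source_\<rho>_def] small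
    proof (eventually_elim, goal_cases)
      case (1 z)
      obtain t x where z: "z = (t, x)" by (cases z)
      from 1(1) obtain \<rho>t mx vt hx where a: "((\<lambda>s. \<rho> s x) has_real_derivative \<rho>t) (at t)"
        "(mass_flow \<rho> v t has_real_derivative mx) (at x)" "((\<lambda>s. v s x) has_real_derivative vt) (at t)"
        "(enthalpy P \<rho> v t has_real_derivative hx) (at x)"
        "\<rho>t + mx = 0" "vt + hx = - \<gamma> * \<bar>v t x\<bar> * v t x + 0"
        unfolding z prod.case by blast
      from 1(2) obtain \<rho>ht mhx vht hhx where b: "((\<lambda>s. \<rho>h s x) has_real_derivative \<rho>ht) (at t)"
        "(mass_flow \<rho>h vh t has_real_derivative mhx) (at x)" "((\<lambda>s. vh s x) has_real_derivative vht) (at t)"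
        "(enthalpy P \<rho>h vh t has_real_derivative hhx) (at x)"
        "\<rho>ht + mhx = 0" "vht + hhx = - \<gamma> * \<bar>vh t x\<bar> * vh t x
          + \<mu> * measured_difference meas \<rho> v \<rho>h vh t x"
        unfolding z prod.case by blast
      \<comment> \<open>(A4) bounds \<open>deriv\<close>, which agrees with the derivatives provided
        by the system at almost every point.\<close>
      have c: "\<bar>\<rho>t\<bar> \<le> \<eta>" "\<bar>vt\<bar> \<le> \<eta>"
        using 1(3,4) unfolding z prod.case DERIV_imp_deriv[OF a(1)] DERIV_imp_deriv[OF a(3)] .
      have a6: "vt + hx = - \<gamma> * \<bar>v t x\<bar> * v t x" using a(6) by (simp only: add_0_right)
      show ?case
        unfolding z prod.case
        by (rule exI[of _ \<rho>t], rule exI[of _ mx], rule exI[of _ vt], rule exI[of _ hx],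
            rule exI[of _ \<rho>ht], rule exI[of _ mhx], rule exI[of _ vht], rule exI[of _ hhx])
          (intro conjI a(5) a6 b(5,6) c a(1-4)[unfolded mass_flow_def[abs_def] enthalpy_def[abs_def]]
            b(1-4)[unfolded mass_flow_def[abs_def] enthalpy_def[abs_def]])
    qed
    from AE_rect_iterated[OF this[unfolded rect_def]] show ?thesis by simp
  qed
  note Lip = reg[THEN regular_imp_Lip]
  show "Lip ({0..T} \<times> {0..l}) (\<lambda>(t, x). \<rho> t x)" "Lip ({0..T} \<times> {0..l}) (\<lambda>(t, x). v t x)"
    "Lip ({0..T} \<times> {0..l}) (\<lambda>(t, x). \<rho>h t x)" "Lip ({0..T} \<times> {0..l}) (\<lambda>(t, x). vh t x)"
    by (rule Lip)+
  have *: "\<bar>u t x\<bar> \<le> \<eta>" if "Lip ({0..T} \<times> {0..l}) (\<lambda>(t, x). u t x)"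
    "Linf_norm (rect T l) (\<lambda>(t, x). u t x) \<le> ereal \<eta>" "t \<in> {0..T}" "x \<in> {0..l}" for u t x
    using continuous_AE_bound[OF T l(1) continuous_on_rabs[OF Lip_continuous[OF that(1)]]
        Linf_norm_AE[OF that(2), unfolded rect_def], of "(t, x)"] that(3,4) by simp
  show "\<bar>v t x\<bar> \<le> \<eta>" "\<bar>vh t x\<bar> \<le> \<eta>" if "t \<in> {0..T}" "x \<in> {0..l}" for t x
    using *[OF Lip(2) vel(1) that] *[OF Lip(4) vel(2) that] by auto
  show "measured_difference meas \<rho> v \<rho>h vh t x = v t x - vh t x \<or>
      measured_difference meas \<rho> v \<rho>h vh t x = \<rho> t x * v t x - \<rho>h t x * vh t x" for t x
    by (cases meas) (auto simp: measured_difference_def)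
qed (use l T range outflow in auto)

section \<open>Existence of admissible constants\<close>

lemma pressure_bounds_exist:
  assumes P: "smooth_on_pos P" and "0 < \<rho>min" "0 < \<rho>max" "0 < vtilde"
    and A2: "\<forall>r\<in>{\<rho>min..\<rho>max}. r * deriv (deriv P) r \<ge> 4 * \<bar>vtilde\<bar>\<^sup>2"
  obtains Dmin Dmax K3 where "0 \<le> K3"
    "pressure_bounds P (deriv P) (deriv (deriv P)) (deriv (deriv (deriv P))) \<rho>min \<rho>max Dmin Dmax K3"
proof -
  have d: "((deriv ^^ n) P has_real_derivative deriv ((deriv ^^ n) P) r) (at r)" if "0 < r" for n r
    using P that unfolding smooth_on_pos_def by (simp add: DERIV_deriv_iff_real_differentiable)
  have D0: "(P has_real_derivative deriv P r) (at r)"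
    and D1: "(deriv P has_real_derivative deriv (deriv P) r) (at r)"
    and D2: "(deriv (deriv P) has_real_derivative deriv (deriv (deriv P)) r) (at r)"
    and D3: "(deriv (deriv (deriv P)) has_real_derivative deriv (deriv (deriv (deriv P))) r) (at r)"
    if "0 < r" for r
    using d[OF that, of 0] d[OF that, of 1] d[OF that, of 2] d[OF that, of 3]
    by (simp_all add: numeral_2_eq_2 numeral_3_eq_3)
  have bd: "\<exists>B\<ge>0. \<forall>r\<in>{\<rho>min..\<rho>max}. \<bar>f r\<bar> \<le> B"
    if "\<And>r. 0 < r \<Longrightarrow> (f has_real_derivative f' r) (at r)" for f f' :: "real \<Rightarrow> real"
  proof -
    have "continuous_on {\<rho>min..\<rho>max} f"
      using \<open>0 < \<rho>min\<close> by (intro continuous_at_imp_continuous_on ballI DERIV_isCont[OF that]) auto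
    from compact_imp_bounded[OF compact_continuous_image[OF this compact_Icc]]
    obtain B where "\<forall>r\<in>{\<rho>min..\<rho>max}. \<bar>f r\<bar> \<le> B" unfolding bounded_iff by auto
    then show ?thesis by (intro exI[of _ "max 0 B"]) (auto simp: le_max_iff_disj)
  qed
  obtain Dmax where Dmax: "\<forall>r\<in>{\<rho>min..\<rho>max}. \<bar>deriv (deriv P) r\<bar> \<le> Dmax" using bd[OF D2] by blast
  obtain K3 where K3: "0 \<le> K3" "\<forall>r\<in>{\<rho>min..\<rho>max}. \<bar>deriv (deriv (deriv P)) r\<bar> \<le> K3" using bd[OF D3] by blast
  \<comment> \<open>(A2) bounds \<open>r\<close> times the second derivative from below; estimating
    \<open>r\<close> by \<open>\<rho>max\<close> gives strong convexity uniformly on the density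
    range.\<close>
  have Dmin: "4 * vtilde\<^sup>2 / \<rho>max \<le> deriv (deriv P) r" if r: "r \<in> {\<rho>min..\<rho>max}" for r
  proof -
    have r0: "0 < r" using r \<open>0 < \<rho>min\<close> by auto
    have a: "4 * vtilde\<^sup>2 \<le> r * deriv (deriv P) r" using A2 r by simp
    moreover have "0 < 4 * vtilde\<^sup>2" using \<open>0 < vtilde\<close> by simp
    ultimately have "0 < r * deriv (deriv P) r" by linarith
    then have "0 < deriv (deriv P) r" using r0 by (simp add: zero_less_mult_iff)
    then have "r * deriv (deriv P) r \<le> \<rho>max * deriv (deriv P) r"
      using r by (intro mult_right_mono) auto
    with a show ?thesis using \<open>0 < \<rho>max\<close> by (simp add: pos_divide_le_eq mult.commute)
  qed
  have "pressure_bounds P (deriv P) (deriv (deriv P)) (deriv (deriv (deriv P))) \<rho>min \<rho>max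
      (4 * vtilde\<^sup>2 / \<rho>max) Dmax K3"
    using assms D0 D1 D2 Dmin Dmax K3 by unfold_locales (auto simp: abs_le_iff)
  then show thesis using that K3(1) by blast
qed

text \<open>Each condition is an upper bound by a positive number: those on
  \<open>\<epsilon>\<close> involve \<open>c0\<close> and the data, those on \<open>\<eta>\<close>
  also \<open>\<epsilon>\<close>. Minima therefore suffice, taken in this order.\<close>

lemma observer_bounds_exist:
  assumes pb: "pressure_bounds P P1 P2 P3 \<rho>min \<rho>max Dmin Dmax K3" and K3: "0 \<le> K3"
    and pos: "0 \<le> \<gamma>" "0 < \<mu>" "1 \<le> L" "0 < \<rho>max"
  obtains \<epsilon> \<eta> c0 where "0 < c0"
    "observer_bounds P P1 P2 P3 \<rho>min \<rho>max Dmin Dmax K3 \<gamma> \<mu> L \<epsilon> \<eta> c0"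
proof -
  interpret pressure_bounds P P1 P2 P3 \<rho>min \<rho>max Dmin Dmax K3 by (rule pb)
  define c0 where "c0 = \<mu> * min \<rho>min (\<rho>min\<^sup>2 / 2)"
  define X where "X = (2 * \<gamma> + \<mu> * (1 + \<rho>max))\<^sup>2 * L\<^sup>2 / Dmin + \<rho>max"
  define \<kappa> where "\<kappa> = min \<rho>min Dmin"
  define \<epsilon> where "\<epsilon> = min 1 (min (c0 / 2 / X) (\<kappa> / 4 / (1 + L\<^sup>2)))"
  define Y where "Y = \<gamma> + \<mu> + (1 + K3) + 2 + \<mu> + \<mu> * L\<^sup>2"
  define \<eta> where "\<eta> = min 1 (min (\<kappa> / 2) (min c0 (\<epsilon> * Dmin) / 4 / Y))"
  have c0: "0 < c0" using pos \<rho>min by (simp add: c0_def)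
  have X: "0 < X" unfolding X_def using pos Dmin(1) by (intro add_nonneg_pos divide_nonneg_nonneg mult_nonneg_nonneg) auto
  have \<kappa>: "0 < \<kappa>" using \<rho>min Dmin(1) by (simp add: \<kappa>_def)
  have L2: "0 < 1 + L\<^sup>2" by (simp add: add_pos_nonneg)
  have \<epsilon>: "0 < \<epsilon>" "\<epsilon> \<le> 1" "\<epsilon> \<le> c0 / 2 / X" "\<epsilon> \<le> \<kappa> / 4 / (1 + L\<^sup>2)"
    using c0 X \<kappa> L2 by (auto simp: \<epsilon>_def)
  have "0 \<le> \<mu> * L\<^sup>2" using pos by simp
  then have Y: "0 < Y" unfolding Y_def using pos assms(2) by linarith
  have \<eta>: "0 < \<eta>" "\<eta> \<le> 1" "\<eta> \<le> \<kappa> / 2" "\<eta> \<le> min c0 (\<epsilon> * Dmin) / 4 / Y"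
    using c0 \<kappa> Y \<epsilon>(1) Dmin(1) by (auto simp: \<eta>_def)
  have "observer_bounds P P1 P2 P3 \<rho>min \<rho>max Dmin Dmax K3 \<gamma> \<mu> L \<epsilon> \<eta> c0"
  proof (unfold_locales, fold X_def \<kappa>_def Y_def)
    show "\<epsilon> * X \<le> c0 / 2" using \<epsilon>(3) X by (simp add: pos_le_divide_eq)
    show "\<epsilon> * (1 + L\<^sup>2) \<le> \<kappa> / 4" using \<epsilon>(4) by (simp only: pos_le_divide_eq[OF L2])
    show "Y * \<eta> \<le> min c0 (\<epsilon> * Dmin) / 4"
      using \<eta>(4) Y by (simp only: pos_le_divide_eq mult.commute)
  qed (use pos \<epsilon> \<eta> c0_def in auto)
  then show thesis using that c0 by blast
qed

text \<open>"Sufficiently small" is expressed by thresholds that are fixed before \<open>Ct\<close>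
  and \<open>vbar\<close>. The decay constants precede \<open>T\<close> and the solutions, hence are
  uniform in them.\<close>

theorem theorem4p15:
  fixes G :: "('v, 'e) pre_digraph" and \<nu>0 :: 'v and len :: "'e \<Rightarrow> real"
    and p P :: "real \<Rightarrow> real" and \<gamma> \<mu> \<rho>min \<rho>max vtilde :: real
    and meas :: measurement
  assumes "star_network G len \<nu>0"
    and "pressure_law p P"
    and "\<gamma> \<ge> 0" and "\<mu> > 0"
    and "\<rho>min > 0" and "\<rho>max > 0" and "vtilde > 0"
    and A2: "\<forall>r\<in>{\<rho>min..\<rho>max}. r * deriv (deriv P) r \<ge> 4 * \<bar>vtilde\<bar>\<^sup>2"
  shows "\<exists>Ct0>0. \<exists>vbar0>0. \<forall>Ct vbar. 0 < Ct \<and> Ct \<le> Ct0 \<and> 0 < vbar \<and> vbar \<le> vbar0 \<longrightarrow>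
    (\<exists>C1>0. \<exists>C2>0. \<exists>C3>0.
      \<forall>(T::real) (\<rho> :: 'e \<Rightarrow> real \<Rightarrow> real \<Rightarrow> real) (v :: 'e \<Rightarrow> real \<Rightarrow> real \<Rightarrow> real)
        (\<rho>h :: 'e \<Rightarrow> real \<Rightarrow> real \<Rightarrow> real) (vh :: 'e \<Rightarrow> real \<Rightarrow> real \<Rightarrow> real)
        (\<rho>0 :: 'e \<Rightarrow> real \<Rightarrow> real) (v0 :: 'e \<Rightarrow> real \<Rightarrow> real)
        (\<rho>h0 :: 'e \<Rightarrow> real \<Rightarrow> real) (vh0 :: 'e \<Rightarrow> real \<Rightarrow> real)
        (mb :: 'e \<Rightarrow> real \<Rightarrow> 'v \<Rightarrow> real).
        T > 0 \<and>
        \<comment> \<open>systems and initial data\<close>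
        (\<forall>e\<in>arcs G.
           original_system P \<gamma> T (len e) (\<rho> e) (v e) \<and>
           observer_system P \<gamma> meas \<mu> T (len e) (\<rho> e) (v e) (\<rho>h e) (vh e) \<and>
           (\<forall>x\<in>{0..len e}. \<rho> e 0 x = \<rho>0 e x \<and> v e 0 x = v0 e x \<and>
                          \<rho>h e 0 x = \<rho>h0 e x \<and> vh e 0 x = vh0 e x)) \<and>
        \<comment> \<open>boundary and coupling conditions\<close>
        boundary_conditions G len T mb \<rho> v \<and> boundary_conditions G len T mb \<rho>h vh \<and>
        coupling_conditions G P T \<rho> v \<and> coupling_conditions G P T \<rho>h vh \<and>
        \<comment> \<open>(A1) and (A3)\<close>
        (\<forall>e\<in>arcs G.
           regular T (len e) (\<rho> e) \<and> regular T (len e) (v e) \<and>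
           regular T (len e) (\<rho>h e) \<and> regular T (len e) (vh e) \<and>
           (\<forall>t\<in>{0..T}. \<forall>x\<in>{0..len e}.
              \<rho>min \<le> \<rho> e t x \<and> \<rho> e t x \<le> \<rho>max \<and> - vtilde \<le> v e t x \<and> v e t x \<le> vtilde \<and>
              \<rho>min \<le> \<rho>h e t x \<and> \<rho>h e t x \<le> \<rho>max \<and> - vtilde \<le> vh e t x \<and> vh e t x \<le> vtilde)) \<and>
        \<comment> \<open>(A4)\<close>
        (\<forall>e\<in>arcs G.
           Linf_norm (rect T (len e)) (\<lambda>(t, x). deriv (\<lambda>s. \<rho> e s x) t) +
             Linf_norm (rect T (len e)) (\<lambda>(t, x). deriv (\<lambda>s. v e s x) t) \<le> ereal Ct \<and>
           Linf_norm (rect T (len e)) (\<lambda>(t, x). v e t x) \<le> ereal vbar \<and>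
           Linf_norm (rect T (len e)) (\<lambda>(t, x). vh e t x) \<le> ereal vbar)
        \<longrightarrow>
        (\<forall>t\<in>{0..T}.
           L2_dist_sq G len (\<lambda>e. \<rho> e t) (\<lambda>e. v e t) (\<lambda>e. \<rho>h e t) (\<lambda>e. vh e t)
             \<le> C1 * L2_dist_sq G len \<rho>0 v0 \<rho>h0 vh0 * exp (- C2 * t)
               + C3 * \<bar>total_mass G len \<rho>0 - total_mass G len \<rho>h0\<bar>))"
proof -
  define A where "A = arcs G"
  have finA: "finite A"
    using assms(1) unfolding star_network_def A_def by (auto dest: fin_digraph.finite_arcs)
  have len: "0 < len e" if "e \<in> A" for e
    using assms(1) that unfolding star_network_def A_def by blast
  have head: "head G e \<in> boundary_nodes G" "e \<in> incident_edges G (head G e)" if "e \<in> A" for e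
    using assms(1) that unfolding star_network_def A_def incident_edges_def in_arcs_def by auto
  \<comment> \<open>One number bounds all lengths and is at least one, so a single choice of
    constants serves every edge.\<close>
  define L where "L = 1 + (\<Sum>e\<in>A. len e)"
  have L1: "1 \<le> L" unfolding L_def using len by (auto intro!: sum_nonneg simp: less_imp_le)
  have lenL: "len e \<le> L" if "e \<in> A" for e
    using member_le_sum[OF that _ finA, of len] len unfolding L_def by (force simp: less_imp_le)
  have smooth: "smooth_on_pos P" using assms(2) unfolding pressure_law_def by blast
  obtain Dmin Dmax K3 where "0 \<le> K3" and
    pb: "pressure_bounds P (deriv P) (deriv (deriv P)) (deriv (deriv (deriv P))) \<rho>min \<rho>max Dmin Dmax K3"
    by (rule pressure_bounds_exist[OF smooth \<open>0 < \<rho>min\<close> \<open>0 < \<rho>max\<close> \<open>0 < vtilde\<close> A2])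
  obtain \<epsilon> \<eta> c0 where c0: "0 < c0" and ob: "observer_bounds P (deriv P) (deriv (deriv P))
      (deriv (deriv (deriv P))) \<rho>min \<rho>max Dmin Dmax K3 \<gamma> \<mu> L \<epsilon> \<eta> c0"
    by (rule observer_bounds_exist[OF pb \<open>0 \<le> K3\<close> \<open>\<gamma> \<ge> 0\<close> \<open>\<mu> > 0\<close> L1 \<open>0 < \<rho>max\<close>])
  interpret observer_bounds P "deriv P" "deriv (deriv P)" "deriv (deriv (deriv P))"
    \<rho>min \<rho>max Dmin Dmax K3 \<gamma> \<mu> L \<epsilon> \<eta> c0 by (rule ob)
  obtain B where B: "0 \<le> B" "\<And>r. r \<in> {\<rho>min..\<rho>max} \<Longrightarrow> \<bar>deriv P r\<bar> \<le> B"
  proof -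
    from compact_imp_bounded[OF compact_continuous_image[OF Lip_continuous[OF Lip_P1] compact_Icc]]
    obtain B where "\<forall>r\<in>{\<rho>min..\<rho>max}. \<bar>deriv P r\<bar> \<le> B" unfolding bounded_iff by auto
    then show thesis using that[of "max 0 B"] by (auto simp: le_max_iff_disj)
  qed
  define \<kappa>1 where "\<kappa>1 = min \<rho>min Dmin / 8"
  define \<kappa>2 where "\<kappa>2 = (max \<rho>max Dmax + 1) / 2 + min \<rho>min Dmin / 8"
  define c3 where "c3 = min (3 / 8 * (\<epsilon> * Dmin)) (c0 / 4)"
  \<comment> \<open>Since the energy is at most \<open>\<kappa>2\<close> times the squared distance,
    dissipation of the distance at rate \<open>c3\<close> is decay of the energy at rate
    \<open>c3 / \<kappa>2\<close>.\<close>
  define C2 where "C2 = c3 / \<kappa>2"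
  define k where "k = \<epsilon> * (1 + 2 * B)"
  have \<kappa>1: "0 < \<kappa>1" using \<rho>min Dmin(1) by (simp add: \<kappa>1_def)
  have \<kappa>2: "0 < \<kappa>2" unfolding \<kappa>2_def using \<rho>min Dmin(1) \<rho>max by (intro add_pos_pos) auto
  have c3: "0 < c3" using \<epsilon>(1) Dmin(1) c0 by (simp add: c3_def)
  have C2: "0 < C2" using c3 \<kappa>2 by (simp add: C2_def)
  have k: "0 < k" using \<epsilon>(1) B(1) by (simp add: k_def)
  have main: "L2_dist_sq G len (\<lambda>e. \<rho> e t) (\<lambda>e. v e t) (\<lambda>e. \<rho>h e t) (\<lambda>e. vh e t)
             \<le> \<kappa>2 / \<kappa>1 * L2_dist_sq G len \<rho>0 v0 \<rho>h0 vh0 * exp (- C2 * t)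
               + k / C2 / \<kappa>1 * \<bar>total_mass G len \<rho>0 - total_mass G len \<rho>h0\<bar>"
    if CV: "Ct \<le> \<eta>" "vbar \<le> \<eta>" and T: "0 < T" and t: "t \<in> {0..T}"
      and sys: "\<forall>e\<in>A. original_system P \<gamma> T (len e) (\<rho> e) (v e) \<and>
           observer_system P \<gamma> meas \<mu> T (len e) (\<rho> e) (v e) (\<rho>h e) (vh e) \<and>
           (\<forall>x\<in>{0..len e}. \<rho> e 0 x = \<rho>0 e x \<and> v e 0 x = v0 e x \<and>
                          \<rho>h e 0 x = \<rho>h0 e x \<and> vh e 0 x = vh0 e x)"
      and bdry: "boundary_conditions G len T mb \<rho> v" "boundary_conditions G len T mb \<rho>h vh"
      and cpl: "coupling_conditions G P T \<rho> v" "coupling_conditions G P T \<rho>h vh"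
      and reg: "\<forall>e\<in>A.
           regular T (len e) (\<rho> e) \<and> regular T (len e) (v e) \<and>
           regular T (len e) (\<rho>h e) \<and> regular T (len e) (vh e) \<and>
           (\<forall>t\<in>{0..T}. \<forall>x\<in>{0..len e}.
              \<rho>min \<le> \<rho> e t x \<and> \<rho> e t x \<le> \<rho>max \<and> - vtilde \<le> v e t x \<and> v e t x \<le> vtilde \<and>
              \<rho>min \<le> \<rho>h e t x \<and> \<rho>h e t x \<le> \<rho>max \<and> - vtilde \<le> vh e t x \<and> vh e t x \<le> vtilde)"
      and small: "\<forall>e\<in>A.
           Linf_norm (rect T (len e)) (\<lambda>(t, x). deriv (\<lambda>s. \<rho> e s x) t) +
             Linf_norm (rect T (len e)) (\<lambda>(t, x). deriv (\<lambda>s. v e s x) t) \<le> ereal Ct \<and>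
           Linf_norm (rect T (len e)) (\<lambda>(t, x). v e t x) \<le> ereal vbar \<and>
           Linf_norm (rect T (len e)) (\<lambda>(t, x). vh e t x) \<le> ereal vbar"
    for Ct vbar T t and \<rho> v \<rho>h vh :: "'e \<Rightarrow> real \<Rightarrow> real \<Rightarrow> real" and \<rho>0 v0 \<rho>h0 vh0 :: "'e \<Rightarrow> real \<Rightarrow> real"
      and mb :: "'e \<Rightarrow> real \<Rightarrow> 'v \<Rightarrow> real"
  proof -
    have edge: "edge_pair P (deriv P) (deriv (deriv P)) (deriv (deriv (deriv P))) \<rho>min \<rho>max Dmin Dmax K3
        \<gamma> \<mu> L \<epsilon> \<eta> c0 T (len e) (\<rho> e) (v e) (\<rho>h e) (vh e)
        (measured_difference meas (\<rho> e) (v e) (\<rho>h e) (vh e))" if e: "e \<in> A" for e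
    proof (rule edge_pairI[OF ob len[OF e] lenL[OF e] T])
      have "ereal Ct \<le> ereal \<eta>" "ereal vbar \<le> ereal \<eta>" using CV by auto
      then show "Linf_norm (rect T (len e)) (\<lambda>(t, x). deriv (\<lambda>s. \<rho> e s x) t) +
          Linf_norm (rect T (len e)) (\<lambda>(t, x). deriv (\<lambda>s. v e s x) t) \<le> ereal \<eta>"
        "Linf_norm (rect T (len e)) (\<lambda>(t, x). v e t x) \<le> ereal \<eta>"
        "Linf_norm (rect T (len e)) (\<lambda>(t, x). vh e t x) \<le> ereal \<eta>"
        using small e by (blast intro: order_trans)+
      show "\<rho> e t (len e) * v e t (len e) = \<rho>h e t (len e) * vh e t (len e)" if "t \<in> {0..T}" for t
        using bdry head[OF e] that unfolding boundary_conditions_def mass_flow_def by metis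
      show "original_system P \<gamma> T (len e) (\<rho> e) (v e)"
        "observer_system P \<gamma> meas \<mu> T (len e) (\<rho> e) (v e) (\<rho>h e) (vh e)"
        using sys e by blast+
      show "regular T (len e) (\<rho> e)" "regular T (len e) (v e)"
        "regular T (len e) (\<rho>h e)" "regular T (len e) (vh e)"
        using reg e by blast+
      show "\<rho>min \<le> \<rho> e t x \<and> \<rho> e t x \<le> \<rho>max \<and> \<rho>min \<le> \<rho>h e t x \<and> \<rho>h e t x \<le> \<rho>max"
        if "t \<in> {0..T}" "x \<in> {0..len e}" for t x
        using reg e that by blast
    qed
    define N where "N e t = integral {0..len e} (\<lambda>x. (\<rho> e t x - \<rho>h e t x)\<^sup>2 + (v e t x - vh e t x)\<^sup>2)" for e t
    define M where "M e t = integral {0..len e} (\<lambda>x. \<rho> e t x - \<rho>h e t x)" for e t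
    define dm where "dm e t = \<rho> e t 0 * v e t 0 - \<rho>h e t 0 * vh e t 0" for e t
    define dh where "dh e t = 1 / 2 * (v e t 0)\<^sup>2 + deriv P (\<rho> e t 0) -
      (1 / 2 * (vh e t 0)\<^sup>2 + deriv P (\<rho>h e t 0))" for e t
    have "\<exists>E. Lip {0..T} E \<and> (\<forall>t\<in>{0..T}. \<kappa>1 * N e t \<le> E t \<and> E t \<le> \<kappa>2 * N e t) \<and>
        (AE t in lebesgue. t \<in> {0<..<T} \<longrightarrow> (\<exists>D. (E has_real_derivative D) (at t) \<and>
          D \<le> - c3 * N e t + dh e t * (dm e t + \<epsilon> * M e t)))" if "e \<in> A" for e
      unfolding N_def M_def dm_def dh_def \<kappa>1_def \<kappa>2_def c3_def
    proof (rule edge_pair.edge_energy[OF edge[OF that]], goal_cases)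
      case (1 E)
      show ?case by (rule exI[of _ E]) (intro conjI ballI 1)
    qed
    then have "\<exists>E. \<forall>e\<in>A. Lip {0..T} (E e) \<and>
        (\<forall>t\<in>{0..T}. \<kappa>1 * N e t \<le> E e t \<and> E e t \<le> \<kappa>2 * N e t) \<and>
        (AE t in lebesgue. t \<in> {0<..<T} \<longrightarrow> (\<exists>D. (E e has_real_derivative D) (at t) \<and>
          D \<le> - c3 * N e t + dh e t * (dm e t + \<epsilon> * M e t)))"
      by (intro bchoice ballI)
    then obtain E where EE: "\<forall>e\<in>A. Lip {0..T} (E e) \<and>
        (\<forall>t\<in>{0..T}. \<kappa>1 * N e t \<le> E e t \<and> E e t \<le> \<kappa>2 * N e t) \<and>
        (AE t in lebesgue. t \<in> {0<..<T} \<longrightarrow> (\<exists>D. (E e has_real_derivative D) (at t) \<and>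
          D \<le> - c3 * N e t + dh e t * (dm e t + \<epsilon> * M e t)))" ..
    note E = EE[rule_format, THEN conjunct1]
      EE[rule_format, THEN conjunct2, THEN conjunct1, rule_format, THEN conjunct1]
      EE[rule_format, THEN conjunct2, THEN conjunct1, rule_format, THEN conjunct2]
      EE[THEN bspec, THEN conjunct2, THEN conjunct2]
    have mass: "Lip {0..T} (M e)"
      "AE t in lebesgue. t \<in> {0<..<T} \<longrightarrow> (M e has_real_derivative dm e t) (at t)" if "e \<in> A" for e
      using edge_pair.edge_mass[OF edge[OF that]] unfolding M_def[abs_def] dm_def by auto
    have dm0: "(\<Sum>e\<in>A. dm e t) = 0" if "t \<in> {0..T}" for t
      using cpl that unfolding coupling_conditions_def mass_flow_def A_def dm_def
      by (simp add: sum_subtractf)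
    have dh_eq: "dh e t = dh f t" if "t \<in> {0..T}" "e \<in> A" "f \<in> A" for t e f
    proof -
      have "enthalpy P (\<rho> e) (v e) t 0 = enthalpy P (\<rho> f) (v f) t 0"
        "enthalpy P (\<rho>h e) (vh e) t 0 = enthalpy P (\<rho>h f) (vh f) t 0"
        using cpl that unfolding coupling_conditions_def A_def by blast+
      then show ?thesis unfolding dh_def enthalpy_def by simp
    qed
    have dh_le: "\<bar>dh e t\<bar> \<le> 1 + 2 * B" if "t \<in> {0..T}" "e \<in> A" for t e
      unfolding dh_def using edge_pair.inlet_enthalpy_bound[OF edge[OF that(2)] that(1) B(2)] .
    \<comment> \<open>The masses on single edges vary, but their rates add up to the net flow
      through the inner node, which vanishes for both systems. Since this holds almost everywhere in
      time, constancy needs \<open>lipschitz_FTC\<close>.\<close>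
    have mass_const: "(\<Sum>e\<in>A. M e t) = (\<Sum>e\<in>A. M e 0)" if t: "t \<in> {0..T}" for t
    proof -
      have "AE s in lebesgue. \<forall>e\<in>A. s \<in> {0<..<T} \<longrightarrow> (M e has_real_derivative dm e s) (at s)"
        using mass(2) by (intro AE_finite_allI finA)
      then have "AE s in lebesgue. s \<in> {0<..<t} \<longrightarrow> ((\<lambda>s. \<Sum>e\<in>A. M e s) has_real_derivative 0) (at s)"
      proof (eventually_elim, intro impI)
        fix s assume *: "\<forall>e\<in>A. s \<in> {0<..<T} \<longrightarrow> (M e has_real_derivative dm e s) (at s)" "s \<in> {0<..<t}"
        then have "((\<lambda>s. \<Sum>e\<in>A. M e s) has_real_derivative (\<Sum>e\<in>A. dm e s)) (at s)"
          using t by (intro DERIV_sum) auto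
        then show "((\<lambda>s. \<Sum>e\<in>A. M e s) has_real_derivative 0) (at s)"
          using dm0[of s] * t by simp
      qed
      moreover have "Lip {0..t} (\<lambda>s. \<Sum>e\<in>A. M e s)"
        using t by (intro Lip_sum Lip_subset[OF mass(1)]) auto
      ultimately have "((\<lambda>_. 0) has_integral ((\<Sum>e\<in>A. M e t) - (\<Sum>e\<in>A. M e 0))) {0..t}"
        using t by (intro lipschitz_FTC) auto
      then show ?thesis using has_integral_unique[OF _ has_integral_0] by force
    qed
    define \<Delta> where "\<Delta> = (\<Sum>e\<in>A. M e 0)"
    have "AE s in lebesgue. \<forall>e\<in>A. s \<in> {0<..<T} \<longrightarrow> (\<exists>D. (E e has_real_derivative D) (at s) \<and>
          D \<le> - c3 * N e s + dh e s * (dm e s + \<epsilon> * M e s))"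
      using E(4) by (intro AE_finite_allI finA)
    then have "AE s in lebesgue. s \<in> {0<..<T} \<longrightarrow> (\<exists>D. ((\<lambda>s. \<Sum>e\<in>A. E e s) has_real_derivative D) (at s) \<and>
        D \<le> k * \<bar>\<Delta>\<bar> - C2 * (\<Sum>e\<in>A. E e s))"
    proof (eventually_elim, intro impI)
      fix s assume "s \<in> {0<..<T}" and "\<forall>e\<in>A. s \<in> {0<..<T} \<longrightarrow> (\<exists>D. (E e has_real_derivative D) (at s) \<and>
          D \<le> - c3 * N e s + dh e s * (dm e s + \<epsilon> * M e s))"
      then have s: "s \<in> {0..T}" and "\<forall>e\<in>A. \<exists>D. (E e has_real_derivative D) (at s) \<and>
          D \<le> - c3 * N e s + dh e s * (dm e s + \<epsilon> * M e s)" by auto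
      then have "\<exists>D. \<forall>e\<in>A. (E e has_real_derivative D e) (at s) \<and>
          D e \<le> - c3 * N e s + dh e s * (dm e s + \<epsilon> * M e s)"
        by (intro bchoice)
      then obtain D where "\<forall>e\<in>A. (E e has_real_derivative D e) (at s) \<and>
          D e \<le> - c3 * N e s + dh e s * (dm e s + \<epsilon> * M e s)" ..
      note D = this[THEN bspec, THEN conjunct1] this[THEN bspec, THEN conjunct2]
      have dE: "((\<lambda>s. \<Sum>e\<in>A. E e s) has_real_derivative (\<Sum>e\<in>A. D e)) (at s)"
        using D(1) by (intro DERIV_sum)
      \<comment> \<open>The enthalpy difference is common to all edges and factors out. The flow
        differences then cancel, and only \<open>\<epsilon>\<close> times the conserved mass
        difference remains. Without edges there is no common value to factor out, hence the case
        distinction.\<close>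
      have inner: "(\<Sum>e\<in>A. dh e s * (dm e s + \<epsilon> * M e s)) \<le> k * \<bar>\<Delta>\<bar>"
      proof (cases "A = {}")
        case True
        then show ?thesis using k by simp
      next
        case False
        then obtain f where f: "f \<in> A" by blast
        have "(\<Sum>e\<in>A. dh e s * (dm e s + \<epsilon> * M e s)) = (\<Sum>e\<in>A. dh f s * (dm e s + \<epsilon> * M e s))"
          using dh_eq[OF s _ f] by (intro sum.cong) auto
        also have "\<dots> = dh f s * (\<epsilon> * \<Delta>)"
          using dm0[OF s] mass_const[OF s]
          by (simp add: \<Delta>_def sum.distrib flip: sum_distrib_left)
        also have "\<dots> \<le> \<bar>dh f s\<bar> * (\<epsilon> * \<bar>\<Delta>\<bar>)"
          using abs_ge_self[of "dh f s * (\<epsilon> * \<Delta>)"] \<epsilon>(1) by (simp add: abs_mult)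
        also have "\<dots> \<le> (1 + 2 * B) * (\<epsilon> * \<bar>\<Delta>\<bar>)"
          using dh_le[OF s f] \<epsilon>(1) by (intro mult_right_mono) auto
        finally show ?thesis by (simp add: k_def mult_ac)
      qed
      have "C2 * (\<Sum>e\<in>A. E e s) \<le> C2 * (\<Sum>e\<in>A. \<kappa>2 * N e s)"
        using E(3)[OF _ s] C2 by (intro mult_left_mono sum_mono) auto
      also have "\<dots> = c3 * (\<Sum>e\<in>A. N e s)"
        using \<kappa>2 by (simp add: C2_def flip: sum_distrib_left)
      finally have decay: "C2 * (\<Sum>e\<in>A. E e s) \<le> c3 * (\<Sum>e\<in>A. N e s)" .
      have "(\<Sum>e\<in>A. D e) \<le> (\<Sum>e\<in>A. - c3 * N e s + dh e s * (dm e s + \<epsilon> * M e s))"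
        using D(2) by (rule sum_mono)
      also have "\<dots> = - c3 * (\<Sum>e\<in>A. N e s) + (\<Sum>e\<in>A. dh e s * (dm e s + \<epsilon> * M e s))"
        by (simp only: sum.distrib sum_distrib_left)
      also have "\<dots> \<le> k * \<bar>\<Delta>\<bar> - C2 * (\<Sum>e\<in>A. E e s)"
        using inner decay by simp
      finally show "\<exists>D. ((\<lambda>s. \<Sum>e\<in>A. E e s) has_real_derivative D) (at s) \<and>
          D \<le> k * \<bar>\<Delta>\<bar> - C2 * (\<Sum>e\<in>A. E e s)" using dE by blast
    qed
    then have "(\<Sum>e\<in>A. E e t) \<le> ((\<Sum>e\<in>A. E e 0) - k * \<bar>\<Delta>\<bar> / C2) * exp (- C2 * t) + k * \<bar>\<Delta>\<bar> / C2"
      using E(1) C2 t by (intro lipschitz_gronwall Lip_sum)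
    \<comment> \<open>The negative multiple of the mass difference in front of the exponential is
      dropped, so that this difference enters only additively.\<close>
    also have "\<dots> \<le> (\<kappa>2 * (\<Sum>e\<in>A. N e 0)) * exp (- C2 * t) + k * \<bar>\<Delta>\<bar> / C2"
    proof (intro add_right_mono mult_right_mono)
      have "(\<Sum>e\<in>A. E e 0) \<le> \<kappa>2 * (\<Sum>e\<in>A. N e 0)"
        unfolding sum_distrib_left using E(3) T by (intro sum_mono) auto
      moreover have "0 \<le> k * \<bar>\<Delta>\<bar> / C2" using k C2 by simp
      ultimately show "(\<Sum>e\<in>A. E e 0) - k * \<bar>\<Delta>\<bar> / C2 \<le> \<kappa>2 * (\<Sum>e\<in>A. N e 0)" by linarith
    qed simp
    also have "\<kappa>1 * (\<Sum>e\<in>A. N e t) \<le> (\<Sum>e\<in>A. E e t)"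
      unfolding sum_distrib_left using E(2) t by (intro sum_mono) auto
    finally have final: "(\<Sum>e\<in>A. N e t) \<le> \<kappa>2 / \<kappa>1 * (\<Sum>e\<in>A. N e 0) * exp (- C2 * t) + k / C2 / \<kappa>1 * \<bar>\<Delta>\<bar>"
      using \<kappa>1 by (simp add: field_simps)
    have cont: "continuous_on {0..len e} (\<rho> e s)" "continuous_on {0..len e} (v e s)"
      "continuous_on {0..len e} (\<rho>h e s)" "continuous_on {0..len e} (vh e s)"
      if "e \<in> A" "s \<in> {0..T}" for e s
      using reg that by (auto intro!: Lip_continuous[OF Lip_slice] regular_imp_Lip)
    have L2: "L2_dist_sq G len (\<lambda>e. \<rho> e s) (\<lambda>e. v e s) (\<lambda>e. \<rho>h e s) (\<lambda>e. vh e s) = (\<Sum>e\<in>A. N e s)"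
      if "s \<in> {0..T}" for s
      unfolding L2_dist_sq_def A_def[symmetric] N_def
      using cont that by (intro sum.cong LINT_lebesgue_on_interval continuous_intros) auto
    have init: "\<rho>0 e x = \<rho> e 0 x" "v0 e x = v e 0 x" "\<rho>h0 e x = \<rho>h e 0 x" "vh0 e x = vh e 0 x"
      if "e \<in> A" "x \<in> {0<..<len e}" for e x
      using sys that by auto
    have "L2_dist_sq G len \<rho>0 v0 \<rho>h0 vh0 = (\<Sum>e\<in>A. N e 0)"
    proof -
      have "L2_dist_sq G len \<rho>0 v0 \<rho>h0 vh0 = L2_dist_sq G len (\<lambda>e. \<rho> e 0) (\<lambda>e. v e 0) (\<lambda>e. \<rho>h e 0) (\<lambda>e. vh e 0)"
        unfolding L2_dist_sq_def A_def[symmetric]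
        by (intro sum.cong Bochner_Integration.integral_cong refl) (auto simp: init)
      then show ?thesis using L2[of 0] T by simp
    qed
    moreover have "total_mass G len \<rho>0 - total_mass G len \<rho>h0 = \<Delta>"
    proof -
      have 0: "0 \<in> {0..T}" using T by simp
      have "total_mass G len \<rho>0 = (\<Sum>e\<in>A. LINT x|lebesgue_on {0<..<len e}. \<rho> e 0 x)"
        unfolding total_mass_def A_def[symmetric]
        by (intro sum.cong Bochner_Integration.integral_cong refl) (auto simp: init)
      moreover have "total_mass G len \<rho>h0 = (\<Sum>e\<in>A. LINT x|lebesgue_on {0<..<len e}. \<rho>h e 0 x)"
        unfolding total_mass_def A_def[symmetric]
        by (intro sum.cong Bochner_Integration.integral_cong refl) (auto simp: init)
      moreover have "(LINT x|lebesgue_on {0<..<len e}. \<rho> e 0 x) - (LINT x|lebesgue_on {0<..<len e}. \<rho>h e 0 x) = M e 0"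
        if "e \<in> A" for e
        unfolding M_def LINT_lebesgue_on_interval[OF cont(1)[OF that 0]] LINT_lebesgue_on_interval[OF cont(3)[OF that 0]]
        by (intro integral_diff[symmetric] integrable_continuous_interval cont that 0)
      ultimately show ?thesis
        unfolding \<Delta>_def by (simp flip: sum_subtractf)
    qed
    ultimately show ?thesis using final L2[OF t] by simp
  qed
  show ?thesis
  proof (rule exI[of _ \<eta>], rule conjI[OF \<eta>(1)], rule exI[of _ \<eta>], rule conjI[OF \<eta>(1)],
      intro allI impI, goal_cases)
    case (1 Ct vbar)
    then have CV: "Ct \<le> \<eta>" "vbar \<le> \<eta>" by simp_all
    have pos: "0 < \<kappa>2 / \<kappa>1" "0 < k / C2 / \<kappa>1" using \<kappa>1 \<kappa>2 k C2 by simp_all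
    show ?case
    proof (rule exI[of _ "\<kappa>2 / \<kappa>1"], rule conjI[OF pos(1)], rule exI[of _ C2], rule conjI[OF C2],
        rule exI[of _ "k / C2 / \<kappa>1"], rule conjI[OF pos(2)], intro allI impI ballI, goal_cases)
      case (1 T \<rho> v \<rho>h vh \<rho>0 v0 \<rho>h0 vh0 mb t)
      note h = 1(1)[folded A_def]
      show ?case
        using main[OF CV _ 1(2), of \<rho> v \<rho>h vh \<rho>0 v0 \<rho>h0 vh0 mb] h by (elim conjE) blast
    qed
  qed
qed

end
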